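(* Let $\gamma>1/2$, let $A:\mathbb{R}^3\to\mathbb{R}^3\otimes\mathbb{R}^3$ be a matrix field with $\|\nabla A\|_2<\infty$, and let $X\in\mathscr{C}^\gamma$. Then there exists a time $T_0>0$, depending only on $\|\nabla A\|_1$, $\|X\|_\gamma^*$ and $\gamma$, such that the equation $$Y(t)_\xi = X_\xi+\int_0^t V^{Y(s)}(Y(s)_\xi)\,ds,\qquad t\in[0,T_0],\ \xi\in[0,1],$$ has a unique solution $Y$ bounded in $\mathscr{C}^\gamma$, i.e. a unique solution $Y\in C([0,T_0],\mathscr{C}^\gamma)$.
   Context: $\mathscr{C}$ is the set of continuous closed curves $X:[0,1]\to\mathbb{R}^3$, $X_0=X_1$. For $X\in\mathscr{C}$: $\|X\|_\gamma=\sup_{\xi\neq\eta}|X_\xi-X_\eta|/|\xi-\eta|^\gamma$, $\|X\|_\infty=\sup_\xi|X_\xi|$, $\|X\|_\gamma^*=\|X\|_\infty+\|X\|_\gamma$; $\mathscr{C}^\gamma=\{X\in\mathscr{C}:\|X\|_\gamma^*<\infty\}$, normed by $\|\cdot\|_\gamma^*$. The space $C([0,T],\mathscr{C}^\gamma)$ has norm $\sup_{t\in[0,T]}\|Y(t)\|_\gamma^*$. For a tensor field $\varphi:\mathbb{R}^3\to(\mathbb{R}^3)^{\otimes m}$: $\|\varphi\|=\sup_{x\in\mathbb{R}^3}|\varphi(x)|$, where the norm of a tensor is the sum of the absolute values of its components, and $\|\varphi\|_n=\sum_{k=0}^n\|\nabla^k\varphi\|$. For $Z\in\mathscr{C}^\gamma$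 the velocity field is $V^Z(x)=\int_0^1A(x-Z_\xi)\,dZ_\xi$ (matrix applied to the vector differential), $x\in\mathbb{R}^3$, the integral being a Young integral. *)

theory Defs
  imports "HOL-Analysis.Analysis"
begin

definition closed_curves :: "(real \<Rightarrow> real^3) set" where
  "closed_curves = {X. path X \<and> pathfinish X = pathstart X}"

text \<open>
  All norms take values in the extended nonnegative reals, so that the suprema exist
  unconditionally and finiteness is a genuine condition. Curves carry the Euclidean norm
  of the ambient space; only their values on the unit interval matter.
\<close>

definition curve_sup_norm :: "(real \<Rightarrow> real^3) \<Rightarrow> ennreal" where
  "curve_sup_norm X = (SUP \<xi>\<in>{0..1}. ennreal (norm (X \<xi>)))"

definition hoelder_seminorm :: "real \<Rightarrow> (real \<Rightarrow> real^3) \<Rightarrow> ennreal" where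
  "hoelder_seminorm \<gamma> X =
     (SUP (\<xi>, \<eta>) \<in> {(\<xi>, \<eta>). \<xi> \<in> {0..1} \<and> \<eta> \<in> {0..1} \<and> \<xi> \<noteq> \<eta>}.
        ennreal (norm (X \<xi> - X \<eta>) / \<bar>\<xi> - \<eta>\<bar> powr \<gamma>))"

definition hoelder_norm :: "real \<Rightarrow> (real \<Rightarrow> real^3) \<Rightarrow> ennreal" where
  "hoelder_norm \<gamma> X = curve_sup_norm X + hoelder_seminorm \<gamma> X"

definition hoelder_curves :: "real \<Rightarrow> (real \<Rightarrow> real^3) set" where
  "hoelder_curves \<gamma> = {X \<in> closed_curves. hoelder_norm \<gamma> X < \<infinity>}"

definition continuous_hoelder_paths :: "real \<Rightarrow> real \<Rightarrow> (real \<Rightarrow> real \<Rightarrow> real^3) set" where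
  "continuous_hoelder_paths T \<gamma> =
     {Y. (\<forall>t\<in>{0..T}. Y t \<in> hoelder_curves \<gamma>) \<and>
         (\<forall>t\<in>{0..T}. ((\<lambda>s. hoelder_norm \<gamma> (\<lambda>\<xi>. Y s \<xi> - Y t \<xi>)) \<longlongrightarrow> 0) (at t within {0..T}))}"

text \<open>
  A tensor of order \<open>m\<close> on three-dimensional space is given by its components, indexed by the
  lists of length \<open>m\<close> over the index type \<open>3\<close>; its values at lists of other lengths are
  irrelevant. The gradient raises the order by one and puts the differentiation index first.
\<close>

type_synonym tensor = "3 list \<Rightarrow> real"

definition tensor_norm :: "nat \<Rightarrow> tensor \<Rightarrow> real" where
  "tensor_norm m T = (\<Sum>is | length is = m. \<bar>T is\<bar>)"

definition grad :: "(real^3 \<Rightarrow> tensor) \<Rightarrow> real^3 \<Rightarrow> tensor" where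
  "grad \<phi> x is = (case is of [] \<Rightarrow> 0
     | k # js \<Rightarrow> frechet_derivative (\<lambda>y. \<phi> y js) (at x) (axis k 1))"

definition field_sup_norm :: "nat \<Rightarrow> (real^3 \<Rightarrow> tensor) \<Rightarrow> ennreal" where
  "field_sup_norm m \<phi> = (SUP x. ennreal (tensor_norm m (\<phi> x)))"

text \<open>\<open>field_norm n m \<phi>\<close> is the norm \<open>\<parallel>\<phi>\<parallel>\<^sub>n\<close> of a field \<open>\<phi>\<close> of tensors of order \<open>m\<close>.\<close>

definition field_norm :: "nat \<Rightarrow> nat \<Rightarrow> (real^3 \<Rightarrow> tensor) \<Rightarrow> ennreal" where
  "field_norm n m \<phi> = (\<Sum>k\<le>n. field_sup_norm (m + k) ((grad ^^ k) \<phi>))"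

text \<open>
  Since \<^const>\<open>frechet_derivative\<close> is a total function, the existence of the derivatives
  is not implied by the finiteness of \<^const>\<open>field_norm\<close>; it is expressed separately.
\<close>

definition field_differentiable_upto :: "nat \<Rightarrow> nat \<Rightarrow> (real^3 \<Rightarrow> tensor) \<Rightarrow> bool" where
  "field_differentiable_upto n m \<phi> \<longleftrightarrow>
     (\<forall>k<n. \<forall>is x. length is = m + k \<longrightarrow> (\<lambda>y. (grad ^^ k) \<phi> y is) differentiable (at x))"

definition matrix_field :: "(real^3 \<Rightarrow> real^3^3) \<Rightarrow> real^3 \<Rightarrow> tensor" where
  "matrix_field A x is = A x $ (is ! 0) $ (is ! 1)"

text \<open>
  The Young integral is the limit of the Riemann--Stieltjes sums over tagged partitions, with
  arbitrary tags, as the mesh tends to zero.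
\<close>

definition has_young_integral ::
    "(real \<Rightarrow> real^'n^'m) \<Rightarrow> (real \<Rightarrow> real^'n) \<Rightarrow> real^'m \<Rightarrow> real \<Rightarrow> real \<Rightarrow> bool" where
  "has_young_integral F g I a b \<longleftrightarrow>
     (\<forall>\<epsilon>>0. \<exists>\<delta>>0. \<forall>p. p tagged_division_of {a..b} \<and> (\<forall>(\<xi>, k)\<in>p. Sup k - Inf k < \<delta>) \<longrightarrow>
        norm ((\<Sum>(\<xi>, k)\<in>p. F \<xi> *v (g (Sup k) - g (Inf k))) - I) < \<epsilon>)"

lemma has_young_integral_unique:
  assumes "has_young_integral F g I a b" and "has_young_integral F g J a b"
  shows "I = J"
proof (rule ccontr)
  assume "I \<noteq> J"
  define e where "e = norm (I - J) / 2"
  have e: "e > 0" using \<open>I \<noteq> J\<close> by (simp add: e_def)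
  let ?S = "\<lambda>p. \<Sum>(\<xi>, k)\<in>p. F \<xi> *v (g (Sup k) - g (Inf k))"
  obtain d where d: "d > 0" "\<And>p. p tagged_division_of {a..b} \<Longrightarrow>
      (\<forall>(\<xi>, k)\<in>p. Sup k - Inf k < d) \<Longrightarrow> norm (?S p - I) < e"
    using assms(1)[unfolded has_young_integral_def, rule_format, OF e] by auto
  obtain d' where d': "d' > 0" "\<And>p. p tagged_division_of {a..b} \<Longrightarrow>
      (\<forall>(\<xi>, k)\<in>p. Sup k - Inf k < d') \<Longrightarrow> norm (?S p - J) < e"
    using assms(2)[unfolded has_young_integral_def, rule_format, OF e] by auto
  define r where "r = min d d' / 3"
  have r: "r > 0" "2 * r < d" "2 * r < d'" using d(1) d'(1) by (auto simp: r_def)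
  obtain p where p: "p tagged_division_of {a..b}" "(\<lambda>x. ball x r) fine p"
    using fine_division_exists_real[OF gauge_ball[OF r(1)]] .
  have mesh: "Sup k - Inf k < 2 * r" if xk: "(x, k) \<in> p" for x k
  proof -
    obtain c f where k: "k = cbox c f" and x: "x \<in> k"
      using tagged_division_ofD(2,4)[OF p(1) xk] by blast
    have "c \<le> f" using k x by auto
    have "k \<subseteq> ball x r" using p(2) xk by (auto simp: fine_def)
    then have "c \<in> ball x r" "f \<in> ball x r" using k \<open>c \<le> f\<close> by (auto simp: subset_iff)
    then have "f - c < 2 * r" by (simp add: dist_real_def abs_if split: if_splits)
    then show ?thesis using k \<open>c \<le> f\<close> by simp
  qed
  have "\<forall>(\<xi>, k)\<in>p. Sup k - Inf k < d" "\<forall>(\<xi>, k)\<in>p. Sup k - Inf k < d'"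
    using mesh r(2,3) by fastforce+
  then have "dist (?S p) I < e" "dist (?S p) J < e"
    using d(2)[OF p(1)] d'(2)[OF p(1)] by (simp_all only: dist_norm)
  then have "dist I J < e + e"
    using dist_triangle3[of I J "?S p"] by linarith
  then show False by (simp add: e_def dist_norm)
qed

definition young_integral ::
    "(real \<Rightarrow> real^'n^'m) \<Rightarrow> (real \<Rightarrow> real^'n) \<Rightarrow> real \<Rightarrow> real \<Rightarrow> real^'m" where
  "young_integral F g a b = (THE I. has_young_integral F g I a b)"

definition velocity :: "(real^3 \<Rightarrow> real^3^3) \<Rightarrow> (real \<Rightarrow> real^3) \<Rightarrow> real^3 \<Rightarrow> real^3" where
  "velocity A Z x = young_integral (\<lambda>\<xi>. A (x - Z \<xi>)) Z 0 1"

definition is_solution :: "real \<Rightarrow> (real^3 \<Rightarrow> real^3^3) \<Rightarrow> (real \<Rightarrow> real^3) \<Rightarrow> real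
    \<Rightarrow> (real \<Rightarrow> real \<Rightarrow> real^3) \<Rightarrow> bool" where
  "is_solution \<gamma> A X T Y \<longleftrightarrow>
     Y \<in> continuous_hoelder_paths T \<gamma> \<and>
     (\<forall>t\<in>{0..T}. \<forall>\<xi>\<in>{0..1}.
        (\<lambda>s. velocity A (Y s) (Y s \<xi>)) integrable_on {0..t} \<and>
        Y t \<xi> = X \<xi> + integral {0..t} (\<lambda>s. velocity A (Y s) (Y s \<xi>)))"

end

theory Submission
  imports Defs
begin

text \<open>
  The equation is an ordinary differential equation \<open>Y' = U(Y)\<close> in the space of closed Hoelder
  curves, with the vector field \<open>U(Z) \<xi> = V\<^sup>Z(Z \<xi>) = \<integral> A(Z \<xi> - Z \<eta>) dZ \<eta>\<close>. It is solved by Picard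
  iteration, and everything rests on two properties of \<open>U\<close> on a ball of radius \<open>R\<close>: it is
  bounded there, by a constant \<open>speed R\<close> that involves \<open>A\<close> only through \<open>\<nabla>A\<close> and \<open>\<nabla>\<^sup>2A\<close>
  (\<open>self_velocity_bounded\<close>), and it is Lipschitz for the Hoelder norm, with a constant that also
  involves \<open>\<nabla>\<^sup>3A\<close> (\<open>self_velocity_lipschitz\<close>).

  Both come from the Young--Loeve estimate. For \<open>\<gamma> > 1/2\<close> and a closed integrator \<open>g\<close> it says that
  \<open>\<integral> F dg\<close> is at most a constant times the product of the Hoelder constants of \<open>F\<close> and \<open>g\<close>
  (\<open>norm_closed_young_integral_le\<close>). The size of \<open>F\<close> itself does not enter, and so \<open>A\<close> may be
  unbounded. Existence of the integral and the estimate both follow from the sewing lemma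
  (\<open>sewing\<close>), which produces a primitive \<open>J\<close> with
  \<open>J t - J s = F s (g t - g s) + O((t - s) powr (2 * \<gamma>))\<close>; along a tagged partition the increments of
  \<open>J\<close> telescope and the errors add up to a positive power of the mesh.

  The Hoelder constants of the integrands are finite differences of \<open>A\<close>: the oscillation of
  \<open>A(Z \<xi> - Z \<eta>)\<close> in \<open>\<eta>\<close> is a difference of first order, comparing two values of \<open>\<xi>\<close> raises the order
  by one, and comparing two curves raises it by one again. Since \<open>Z \<xi> - Z \<eta>\<close> is a difference of a
  function of \<open>\<xi>\<close> and a function of \<open>\<eta>\<close>, these are exactly iterated increments of \<open>A\<close>
  in constant directions, and each is bounded by a derivative of the same order
  (\<open>increment_matrix_field_le\<close>).

  The existence time must not depend on \<open>\<nabla>\<^sup>3A\<close>. It is therefore chosen only such that the iterates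
  stay in the ball of radius \<open>R\<close>, one more than the norm of the initial curve, which needs
  \<open>T * speed R \<le> 1\<close>. That the Lipschitz constant
  \<open>L\<close> may be large compared with \<open>1 / T\<close> is harmless, because in the norm weighted by \<open>exp (- 2 * L * t)\<close>
  the Picard map halves distances on every time interval (\<open>picard_step_contraction\<close>). The same
  contraction, on a ball that contains two given solutions, gives uniqueness.
\<close>

section \<open>The sewing lemma\<close>

text \<open>
  The solution \<open>c\<close> of \<open>c = 2 powr (1 - \<theta>) * c + 2\<close>, the recursion in the bisection argument below.
\<close>
definition sewing_const :: "real \<Rightarrow> real" where
  "sewing_const \<theta> = 2 / (1 - 2 powr (1 - \<theta>))"

lemma sewing_const_pos: "\<theta> > 1 \<Longrightarrow> sewing_const \<theta> > 0"
proof -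
  assume "\<theta> > 1"
  then have "2 powr (1 - \<theta>) < (2::real) powr 0"
    by (intro powr_less_mono) auto
  then show ?thesis by (simp add: sewing_const_def)
qed

lemma sewing_diagonal:
  fixes \<Xi> :: "real \<Rightarrow> real \<Rightarrow> 'b::real_normed_vector"
  assumes \<delta>: "\<And>s u t. 0 \<le> s \<Longrightarrow> s \<le> u \<Longrightarrow> u \<le> t \<Longrightarrow> t \<le> 1 \<Longrightarrow>
      norm (\<Xi> s t - \<Xi> s u - \<Xi> u t) \<le> M * (t - s) powr \<theta>"
    and "0 \<le> s" "s \<le> 1"
  shows "\<Xi> s s = 0"
  using \<delta>[of s s s] assms(2,3) by simp

text \<open>
  Cut the partition at the cell that contains the midpoint of \<open>[x l, x m]\<close>. Both remaining pieces
  have at most half the length, and two halves cost \<open>2 * (w / 2) powr \<theta> = 2 powr (1 - \<theta>) * w powr \<theta>\<close>, less than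
  the whole because \<open>\<theta> > 1\<close>; the difference pays for the two uses of the
  hypothesis that separate the three parts. The bound is uniform in the number of points.
\<close>
lemma sewing_partition_bound:
  fixes \<Xi> :: "real \<Rightarrow> real \<Rightarrow> 'b::real_normed_vector" and x :: "nat \<Rightarrow> real"
  assumes \<delta>: "\<And>s u t. 0 \<le> s \<Longrightarrow> s \<le> u \<Longrightarrow> u \<le> t \<Longrightarrow> t \<le> 1 \<Longrightarrow>
      norm (\<Xi> s t - \<Xi> s u - \<Xi> u t) \<le> M * (t - s) powr \<theta>"
    and \<theta>: "\<theta> > 1" and M: "M \<ge> 0"
    and mono: "\<And>i j. i \<le> j \<Longrightarrow> x i \<le> x j"
    and range: "\<And>i. x i \<in> {0..1}" and "l \<le> m"
  shows "norm ((\<Sum>i=l..<m. \<Xi> (x i) (x (Suc i))) - \<Xi> (x l) (x m))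
     \<le> sewing_const \<theta> * M * (x m - x l) powr \<theta>"
  using \<open>l \<le> m\<close>
proof (induction "m - l" arbitrary: l m rule: less_induct)
  case less
  let ?C = "sewing_const \<theta> * M"
  let ?S = "\<lambda>l m. \<Sum>i=l..<m. \<Xi> (x i) (x (Suc i))"
  have C: "?C \<ge> 0" using sewing_const_pos[OF \<theta>] M by simp
  have range': "0 \<le> x i" "x i \<le> 1" for i using range[of i] by auto
  show ?case
  proof (cases "l = m")
    case True
    then show ?thesis using sewing_diagonal[where \<Xi>=\<Xi>, OF \<delta> range'] by simp
  next
    case False
    with less.prems have "l < m" by simp
    define w where "w = x m - x l"
    have w: "w \<ge> 0" using mono[OF less.prems] by (simp add: w_def)
    \<comment> \<open>\<open>j\<close> will be the last index in the left half, so that its cell contains the midpoint.\<close>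
    define J where "J = {j. l \<le> j \<and> j < m \<and> x j \<le> x l + w / 2}"
    have "finite J" "l \<in> J" using \<open>l < m\<close> w by (auto simp: J_def)
    define j where "j = Max J"
    have "j \<in> J" using \<open>finite J\<close> \<open>l \<in> J\<close> unfolding j_def by (metis Max_in empty_iff)
    then have j: "l \<le> j" "j < m" "x j \<le> x l + w / 2" by (auto simp: J_def)
    have j': "x m - x (Suc j) \<le> w / 2"
    proof (cases "Suc j = m")
      case True then show ?thesis using w by simp
    next
      case False
      have "Suc j \<notin> J" using Max_ge[OF \<open>finite J\<close>, of "Suc j"] unfolding j_def by linarith
      then have "x (Suc j) > x l + w / 2" using False j by (auto simp: J_def)
      then show ?thesis unfolding w_def by (simp add: field_simps)
    qed
    have split: "?S l m = ?S l j + \<Xi> (x j) (x (Suc j)) + ?S (Suc j) m"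
      using j by (metis (no_types, lifting) less_imp_le_nat sum.atLeastLessThan_concat
          sum.atLeast_Suc_lessThan add.assoc)
    have half: "?C * r powr \<theta> \<le> ?C * (w / 2) powr \<theta>" if "0 \<le> r" "r \<le> w / 2" for r
      using that C \<theta> by (intro mult_left_mono powr_mono2) auto
    have 1: "norm (?S l j - \<Xi> (x l) (x j)) \<le> ?C * (w / 2) powr \<theta>"
      using less.hyps[of j l] j mono[of l j] half[of "x j - x l"] by linarith
    have 2: "norm (?S (Suc j) m - \<Xi> (x (Suc j)) (x m)) \<le> ?C * (w / 2) powr \<theta>"
      using less.hyps[of m "Suc j"] j j' mono[of "Suc j" m] half[of "x m - x (Suc j)"] by linarith
    have 3: "norm (\<Xi> (x l) (x m) - \<Xi> (x l) (x j) - \<Xi> (x j) (x m)) \<le> M * w powr \<theta>"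
      unfolding w_def using j mono range' by (intro \<delta>) auto
    have "norm (\<Xi> (x j) (x m) - \<Xi> (x j) (x (Suc j)) - \<Xi> (x (Suc j)) (x m)) \<le> M * (x m - x j) powr \<theta>"
      using j mono range' by (intro \<delta>) auto
    also have "\<dots> \<le> M * w powr \<theta>"
      using M \<theta> j mono[of j m] mono[of l j] by (intro mult_left_mono powr_mono2) (auto simp: w_def)
    finally have 4: "norm (\<Xi> (x j) (x m) - \<Xi> (x j) (x (Suc j)) - \<Xi> (x (Suc j)) (x m)) \<le> M * w powr \<theta>" .
    have eq: "?S l m - \<Xi> (x l) (x m) = (?S l j - \<Xi> (x l) (x j)) + (?S (Suc j) m - \<Xi> (x (Suc j)) (x m))
        - (\<Xi> (x l) (x m) - \<Xi> (x l) (x j) - \<Xi> (x j) (x m))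
        - (\<Xi> (x j) (x m) - \<Xi> (x j) (x (Suc j)) - \<Xi> (x (Suc j)) (x m))"
      by (simp add: split)
    have "norm (?S l m - \<Xi> (x l) (x m)) \<le> 2 * (?C * (w / 2) powr \<theta>) + 2 * (M * w powr \<theta>)"
      unfolding eq using 1 2 3 4
      by (smt (verit) norm_triangle_ineq norm_triangle_ineq4)
    also have "2 * (?C * (w / 2) powr \<theta>) = ?C * 2 powr (1 - \<theta>) * w powr \<theta>"
      using w by (simp add: powr_divide powr_diff)
    also have "?C * 2 powr (1 - \<theta>) * w powr \<theta> + 2 * (M * w powr \<theta>) = ?C * w powr \<theta>"
    proof -
      have "1 - 2 powr (1 - \<theta>) \<noteq> 0" using sewing_const_pos[OF \<theta>] by (auto simp: sewing_const_def)
      then have "sewing_const \<theta> * 2 powr (1 - \<theta>) + 2 = sewing_const \<theta>"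
        unfolding sewing_const_def by (simp add: field_simps)
      then have "(sewing_const \<theta> * 2 powr (1 - \<theta>) + 2) * (M * w powr \<theta>) = sewing_const \<theta> * (M * w powr \<theta>)"
        by simp
      then show ?thesis by (simp add: algebra_simps)
    qed
    finally show ?thesis by (simp add: w_def)
  qed
qed

lemma convergent_geometric_steps:
  fixes f :: "nat \<Rightarrow> 'b::banach"
  assumes "\<And>n. norm (f (Suc n) - f n) \<le> B * q ^ n" "0 \<le> q" "q < 1"
  shows "convergent f"
proof -
  have "summable (\<lambda>n. B * q ^ n)" using assms by (intro summable_mult summable_geometric) auto
  then have "summable (\<lambda>n. f (Suc n) - f n)"
    by (rule summable_comparison_test') (use assms(1) in blast)
  then have "convergent (\<lambda>n. f 0 + (\<Sum>k<n. f (Suc k) - f k))"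
    by (intro convergent_add convergent_const) (simp add: summable_iff_convergent)
  then show ?thesis by (simp add: sum_lessThan_telescope[of f])
qed

lemma sum_split_pairs: "(\<Sum>i<2 * n. f i) = (\<Sum>i<n. f (2 * i) + f (2 * i + 1))"
  for f :: "nat \<Rightarrow> 'b::comm_monoid_add"
  by (induction n) (simp_all add: ac_simps)

text \<open>
  The primitive is the limit of the sums of \<open>\<Xi>\<close> over the dyadic partitions clipped at \<open>t\<close>.
  Refining the partition once changes a sum by at most \<open>2 ^ n\<close> defects of size
  \<open>M * 2 powr (- n * \<theta>)\<close>, which is geometrically small. The increment from \<open>s\<close> to \<open>t\<close> is, up to the same error,
  the sum over the partition of \<open>[s, t]\<close> by dyadic points, and that sum is within
  the uniform partition bound of \<open>\<Xi> s t\<close>.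
\<close>
lemma sewing:
  fixes \<Xi> :: "real \<Rightarrow> real \<Rightarrow> 'b::banach"
  assumes \<delta>: "\<And>s u t. 0 \<le> s \<Longrightarrow> s \<le> u \<Longrightarrow> u \<le> t \<Longrightarrow> t \<le> 1 \<Longrightarrow>
      norm (\<Xi> s t - \<Xi> s u - \<Xi> u t) \<le> M * (t - s) powr \<theta>"
    and \<theta>: "\<theta> > 1" and M: "M \<ge> 0"
  obtains J where "\<And>s t. 0 \<le> s \<Longrightarrow> s \<le> t \<Longrightarrow> t \<le> 1 \<Longrightarrow>
      norm (J t - J s - \<Xi> s t) \<le> sewing_const \<theta> * M * (t - s) powr \<theta>"
proof -
  define a where "a n i = real i / 2 ^ n" for n i :: nat
  define q where "q = (2::real) powr (1 - \<theta>)"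
  have q: "0 < q" "q < 1"
    using sewing_const_pos[OF \<theta>] by (auto simp: q_def sewing_const_def zero_less_divide_iff)
  have a: "0 \<le> a n i" "a n i \<le> a n (Suc i)" "a n (Suc i) - a n i = 1 / 2 ^ n"
    "a (Suc n) (2 * i) = a n i" "a (Suc n) (Suc (Suc (2 * i))) = a n (Suc i)" for n i
    by (auto simp: a_def divide_simps)
  \<comment> \<open>The total of one defect per cell of level \<open>n\<close>.\<close>
  have cells: "2 ^ n * (M * (1 / 2 ^ n) powr \<theta>) = M * q ^ n" for n
  proof -
    have "(1 / 2 ^ n) powr \<theta> = (2::real) powr (- \<theta> * real n)"
      by (simp add: powr_realpow[symmetric] powr_powr powr_minus_divide[symmetric] mult.commute)
    moreover have "q ^ n = 2 ^ n * 2 powr (- \<theta> * real n)"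
      by (simp add: q_def powr_realpow[symmetric] powr_powr powr_add[symmetric] algebra_simps)
    ultimately show ?thesis by simp
  qed
  have cell: "M * r powr \<theta> \<le> M * (1 / 2 ^ n) powr \<theta>" if "0 \<le> r" "r \<le> 1 / 2 ^ n" for r n
    using that M \<theta> by (intro mult_left_mono powr_mono2) auto
  define Jn where "Jn n t = (\<Sum>i<2 ^ n. \<Xi> (min t (a n i)) (min t (a n (Suc i))))" for n t
  have step: "norm (Jn (Suc n) t - Jn n t) \<le> M * q ^ n" if t: "0 \<le> t" "t \<le> 1" for n t
  proof -
    let ?\<Xi> = "\<lambda>b c. \<Xi> (min t b) (min t c)"
    let ?c = "\<lambda>i. a (Suc n) (Suc (2 * i))"
    have c: "a n i \<le> ?c i" "?c i \<le> a n (Suc i)" for i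
      using a(2)[of "Suc n" "2 * i"] a(2)[of "Suc n" "Suc (2 * i)"] by (simp_all add: a)
    have "Jn (Suc n) t = (\<Sum>i<2 ^ n. ?\<Xi> (a n i) (?c i) + ?\<Xi> (?c i) (a n (Suc i)))"
      by (simp add: Jn_def sum_split_pairs a)
    then have "Jn (Suc n) t - Jn n t =
        (\<Sum>i<2 ^ n. - (?\<Xi> (a n i) (a n (Suc i)) - ?\<Xi> (a n i) (?c i) - ?\<Xi> (?c i) (a n (Suc i))))"
      by (simp add: Jn_def sum_subtractf[symmetric] algebra_simps)
    also have "norm \<dots> \<le> (\<Sum>i<(2::nat) ^ n. M * (1 / 2 ^ n) powr \<theta>)"
    proof (rule sum_norm_le)
      fix i
      have "norm (?\<Xi> (a n i) (a n (Suc i)) - ?\<Xi> (a n i) (?c i) - ?\<Xi> (?c i) (a n (Suc i)))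
          \<le> M * (min t (a n (Suc i)) - min t (a n i)) powr \<theta>"
        using c[of i] t a(1)[of n i] by (intro \<delta>) auto
      also have "\<dots> \<le> M * (1 / 2 ^ n) powr \<theta>"
        using a(2,3)[of n i] by (intro cell) auto
      finally show "norm (- (?\<Xi> (a n i) (a n (Suc i)) - ?\<Xi> (a n i) (?c i) - ?\<Xi> (?c i) (a n (Suc i))))
          \<le> M * (1 / 2 ^ n) powr \<theta>" by (simp only: norm_minus_cancel)
    qed
    also have "\<dots> = M * q ^ n" by (simp add: cells)
    finally show ?thesis .
  qed
  have "convergent (\<lambda>n. Jn n t)" if "0 \<le> t" "t \<le> 1" for t
    using convergent_geometric_steps[of "\<lambda>n. Jn n t", OF step] q that by simp
  then obtain J where J: "\<And>t. 0 \<le> t \<Longrightarrow> t \<le> 1 \<Longrightarrow> (\<lambda>n. Jn n t) \<longlonglongrightarrow> J t"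
    unfolding convergent_def by metis
  show thesis
  proof (rule that)
    fix s t :: real
    assume st: "0 \<le> s" "s \<le> t" "t \<le> 1"
    let ?x = "\<lambda>n i. max s (min t (a n i))"
    let ?Sn = "\<lambda>n. \<Sum>i=0..<2 ^ n. \<Xi> (?x n i) (?x n (Suc i))"
    have mono_a: "a n i \<le> a n j" if "i \<le> j" for n i j using that by (auto simp: a_def divide_simps)
    have main: "norm (?Sn n - \<Xi> s t) \<le> sewing_const \<theta> * M * (t - s) powr \<theta>" for n
    proof -
      have "norm (?Sn n - \<Xi> (?x n 0) (?x n (2 ^ n)))
          \<le> sewing_const \<theta> * M * (?x n (2 ^ n) - ?x n 0) powr \<theta>"
      proof (rule sewing_partition_bound[OF \<delta> \<theta> M])
        show "?x n i \<le> ?x n j" if "i \<le> j" for i j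
          by (intro max.mono min.mono order_refl mono_a that)
        show "?x n i \<in> {0..1}" for i using st by auto
      qed auto
      moreover have "?x n 0 = s" "?x n (2 ^ n) = t" using st by (auto simp: a_def)
      ultimately show ?thesis by simp
    qed
    have err: "norm (Jn n t - Jn n s - ?Sn n) \<le> M * q ^ n" for n
    proof -
      let ?T = "\<lambda>i. \<Xi> (min t (a n i)) (min t (a n (Suc i))) - \<Xi> (min s (a n i)) (min s (a n (Suc i)))
         - \<Xi> (?x n i) (?x n (Suc i))"
      have eq: "Jn n t - Jn n s - ?Sn n = (\<Sum>i<2 ^ n. ?T i)"
        by (simp add: Jn_def sum_subtractf atLeast0LessThan)
      have "norm (\<Sum>i<(2::nat) ^ n. ?T i) \<le> (\<Sum>i<(2::nat) ^ n. M * (1 / 2 ^ n) powr \<theta>)"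
      proof (rule sum_norm_le)
        fix i
        have ss: "\<Xi> s s = 0" using sewing_diagonal[where \<Xi>=\<Xi>, OF \<delta>] st by auto
        \<comment> \<open>Only a cell with \<open>s\<close> in its interior gives a nonzero term.\<close>
        consider "a n (Suc i) \<le> s" | "s \<le> a n i" | "a n i < s" "s < a n (Suc i)" by linarith
        then show "norm (?T i) \<le> M * (1 / 2 ^ n) powr \<theta>"
        proof cases
          case 1
          then have "min t (a n i) = min s (a n i)" "min t (a n (Suc i)) = min s (a n (Suc i))"
            "?x n i = s" "?x n (Suc i) = s"
            using a(2)[of n i] st by auto
          then have "?T i = - \<Xi> s s" by simp
          then show ?thesis using ss M by simp
        next
          case 2
          then have "min s (a n i) = s" "min s (a n (Suc i)) = s" "?x n i = min t (a n i)"
            "?x n (Suc i) = min t (a n (Suc i))"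
            using a(2)[of n i] st by auto
          then have "?T i = - \<Xi> s s" by simp
          then show ?thesis using ss M by simp
        next
          case 3
          then have "min t (a n i) = a n i" "min s (a n i) = a n i" "min s (a n (Suc i)) = s"
            "?x n i = s" "?x n (Suc i) = min t (a n (Suc i))"
            using st by auto
          then have "norm (?T i) \<le> M * (min t (a n (Suc i)) - a n i) powr \<theta>"
            using \<delta>[of "a n i" s "min t (a n (Suc i))"] 3 st a(1)[of n i] by simp
          also have "\<dots> \<le> M * (1 / 2 ^ n) powr \<theta>"
            using a(3)[of n i] 3 st by (intro cell) auto
          finally show ?thesis .
        qed
      qed
      then show ?thesis unfolding eq by (simp add: cells)
    qed
    have lim1: "(\<lambda>n. norm (Jn n t - Jn n s - \<Xi> s t)) \<longlonglongrightarrow> norm (J t - J s - \<Xi> s t)"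
      using st by (intro tendsto_intros J) auto
    have lim2: "(\<lambda>n. M * q ^ n + sewing_const \<theta> * M * (t - s) powr \<theta>)
        \<longlonglongrightarrow> M * 0 + sewing_const \<theta> * M * (t - s) powr \<theta>"
      using q by (intro tendsto_intros LIMSEQ_power_zero) auto
    have "norm (Jn n t - Jn n s - \<Xi> s t) \<le> M * q ^ n + sewing_const \<theta> * M * (t - s) powr \<theta>" for n
      using norm_triangle_ineq[of "Jn n t - Jn n s - ?Sn n" "?Sn n - \<Xi> s t"] err[of n] main[of n] by simp
    then show "norm (J t - J s - \<Xi> s t) \<le> sewing_const \<theta> * M * (t - s) powr \<theta>"
      using LIMSEQ_le[OF lim1 lim2] by simp
  qed
qed

section \<open>Young integrals of Hoelder functions\<close>

definition hoelder_bound :: "real \<Rightarrow> real \<Rightarrow> (real \<Rightarrow> 'a::real_normed_vector) \<Rightarrow> bool" where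
  "hoelder_bound \<gamma> a f \<longleftrightarrow> (\<forall>\<xi>\<in>{0..1}. \<forall>\<eta>\<in>{0..1}. norm (f \<xi> - f \<eta>) \<le> a * \<bar>\<xi> - \<eta>\<bar> powr \<gamma>)"

lemma hoelder_boundD:
  "hoelder_bound \<gamma> a f \<Longrightarrow> \<xi> \<in> {0..1} \<Longrightarrow> \<eta> \<in> {0..1} \<Longrightarrow> norm (f \<xi> - f \<eta>) \<le> a * \<bar>\<xi> - \<eta>\<bar> powr \<gamma>"
  by (auto simp: hoelder_bound_def)

lemma hoelder_bound_nonneg: "hoelder_bound \<gamma> a f \<Longrightarrow> a \<ge> 0"
  using order_trans[OF norm_ge_zero hoelder_boundD[of \<gamma> a f 1 0]] by simp

text \<open>
  The norm of \<open>M\<close> is its Frobenius norm, so this is the Cauchy--Schwarz inequality row by row.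
\<close>
lemma norm_matrix_vector_mult_le: "norm (M *v x) \<le> norm M * norm x"
  for M :: "real^'n^'m"
proof -
  have "norm (M *v x) = L2_set (\<lambda>i. inner (M $ i) x) UNIV"
    by (simp add: norm_vec_def matrix_vector_mul_component L2_set_def)
  also have "\<dots> \<le> L2_set (\<lambda>i. norm (M $ i) * norm x) UNIV"
    unfolding L2_set_def by (intro real_sqrt_le_mono sum_mono) (metis Cauchy_Schwarz_ineq2 abs_le_square_iff abs_mult abs_norm_cancel)
  also have "\<dots> = norm M * norm x"
    by (simp add: L2_set_left_distrib[symmetric] norm_vec_def[of M])
  finally show ?thesis .
qed

definition young_const :: "real \<Rightarrow> real" where
  "young_const \<gamma> = sewing_const (2 * \<gamma>)"

lemma young_const_pos: "\<gamma> > 1/2 \<Longrightarrow> young_const \<gamma> > 0"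
  by (simp add: young_const_def sewing_const_pos)

text \<open>
  The germ \<open>F s (g t - g s)\<close> fails to be additive by \<open>(F s - F u) (g t - g u)\<close>, a product of two
  Hoelder increments, hence of order \<open>2 * \<gamma> > 1\<close>: the sewing lemma applies.
\<close>
lemma young_primitive:
  fixes F :: "real \<Rightarrow> real^'n^'m" and g :: "real \<Rightarrow> real^'n"
  assumes \<gamma>: "\<gamma> > 1/2" and F: "hoelder_bound \<gamma> a F" and g: "hoelder_bound \<gamma> b g"
  obtains J where "\<And>s t. 0 \<le> s \<Longrightarrow> s \<le> t \<Longrightarrow> t \<le> 1 \<Longrightarrow>
      norm (J t - J s - F s *v (g t - g s)) \<le> young_const \<gamma> * (a * b) * (t - s) powr (2 * \<gamma>)"
proof -
  have ab: "a \<ge> 0" "b \<ge> 0" using F g hoelder_bound_nonneg by auto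
  have "norm (F s *v (g t - g s) - F s *v (g u - g s) - F u *v (g t - g u))
      \<le> a * b * (t - s) powr (2 * \<gamma>)" if "0 \<le> s" "s \<le> u" "u \<le> t" "t \<le> 1" for s u t
  proof -
    have "F s *v (g t - g s) - F s *v (g u - g s) - F u *v (g t - g u) = (F s - F u) *v (g t - g u)"
      by (simp add: matrix_vector_mult_diff_distrib matrix_vector_mult_diff_rdistrib)
    also have "norm \<dots> \<le> norm (F s - F u) * norm (g t - g u)"
      by (rule norm_matrix_vector_mult_le)
    also have "\<dots> \<le> (a * \<bar>s - u\<bar> powr \<gamma>) * (b * \<bar>t - u\<bar> powr \<gamma>)"
      using that ab by (intro mult_mono hoelder_boundD[OF F] hoelder_boundD[OF g]) auto
    also have "\<dots> \<le> (a * (t - s) powr \<gamma>) * (b * (t - s) powr \<gamma>)"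
      using that ab \<gamma> by (intro mult_mono powr_mono2) auto
    also have "\<dots> = a * b * (t - s) powr (2 * \<gamma>)"
      by (simp add: powr_add[symmetric])
    finally show ?thesis .
  qed
  then show thesis
    using sewing[of "\<lambda>s t. F s *v (g t - g s)" "a * b" "2 * \<gamma>" thesis] that \<gamma> ab
    by (auto simp: young_const_def)
qed

text \<open>
  Moving the tag from the left end point to \<open>\<xi>\<close> costs another term of order \<open>2 * \<gamma>\<close> on each cell, so that
  arbitrary tags are covered. A cell of length \<open>r < \<delta>\<close> contributes an error of order
  \<open>\<delta> powr (2 * \<gamma> - 1) * r\<close>, and the lengths add up to \<open>1\<close>.
\<close>
lemma has_young_integral_primitive:
  fixes F :: "real \<Rightarrow> real^'n^'m" and g :: "real \<Rightarrow> real^'n"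
  assumes \<gamma>: "\<gamma> > 1/2" and F: "hoelder_bound \<gamma> a F" and g: "hoelder_bound \<gamma> b g"
    and J: "\<And>s t. 0 \<le> s \<Longrightarrow> s \<le> t \<Longrightarrow> t \<le> 1 \<Longrightarrow>
      norm (J t - J s - F s *v (g t - g s)) \<le> c * (t - s) powr (2 * \<gamma>)"
  shows "has_young_integral F g (J 1 - J 0) 0 1"
  unfolding has_young_integral_def
proof (intro allI impI)
  fix \<epsilon> :: real assume "\<epsilon> > 0"
  have ab: "a \<ge> 0" "b \<ge> 0" using F g hoelder_bound_nonneg by auto
  have c: "c \<ge> 0" using order_trans[OF norm_ge_zero J[of 0 1]] by simp
  \<comment> \<open>\<open>c\<close> is the cost of the left end point, \<open>a * b\<close> that of moving the tag; \<open>1\<close> makes the sum positive.\<close>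
  define K where "K = c + a * b + 1"
  have K: "K > 0" using c ab by (simp add: K_def add_nonneg_pos)
  define \<delta> where "\<delta> = (\<epsilon> / (2 * K)) powr (1 / (2 * \<gamma> - 1))"
  have "\<delta> > 0" using \<open>\<epsilon> > 0\<close> K by (simp add: \<delta>_def)
  have \<delta>: "\<delta> powr (2 * \<gamma> - 1) = \<epsilon> / (2 * K)"
    using \<gamma> \<open>\<epsilon> > 0\<close> K by (simp add: \<delta>_def powr_powr)
  show "\<exists>\<delta>>0. \<forall>p. p tagged_division_of {0..1} \<and> (\<forall>(\<xi>, k)\<in>p. Sup k - Inf k < \<delta>) \<longrightarrow>
      norm ((\<Sum>(\<xi>, k)\<in>p. F \<xi> *v (g (Sup k) - g (Inf k))) - (J 1 - J 0)) < \<epsilon>"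
  proof (intro exI[of _ \<delta>] conjI allI impI \<open>\<delta> > 0\<close>, elim conjE)
    fix p :: "(real \<times> real set) set"
    assume p: "p tagged_division_of {0..1}" and mesh: "\<forall>(\<xi>, k)\<in>p. Sup k - Inf k < \<delta>"
    have len: "(\<Sum>(\<xi>, k)\<in>p. Sup k - Inf k) = 1"
      using additive_tagged_division_1[OF _ p, of "\<lambda>x. x"] by simp
    have tel: "(\<Sum>(\<xi>, k)\<in>p. J (Sup k) - J (Inf k)) = J 1 - J 0"
      using additive_tagged_division_1[OF _ p, of J] by simp
    have cell: "norm (F \<xi> *v (g (Sup k) - g (Inf k)) - (J (Sup k) - J (Inf k)))
        \<le> \<epsilon> / 2 * (Sup k - Inf k)" if xk: "(\<xi>, k) \<in> p" for \<xi> k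
    proof -
      obtain s t where k: "k = cbox s t" and \<xi>: "\<xi> \<in> k"
        using tagged_division_ofD(2,4)[OF p xk] by blast
      have "k \<subseteq> {0..1}" using tagged_division_ofD(3)[OF p xk] by simp
      with k \<xi> have st: "s \<le> \<xi>" "\<xi> \<le> t" "0 \<le> s" "t \<le> 1" by auto
      have ends: "Sup k = t" "Inf k = s" using k st by auto
      have w: "0 \<le> t - s" "t - s < \<delta>" using mesh xk ends st by auto
      have "norm ((F \<xi> - F s) *v (g t - g s)) \<le> norm (F \<xi> - F s) * norm (g t - g s)"
        by (rule norm_matrix_vector_mult_le)
      also have "\<dots> \<le> (a * \<bar>\<xi> - s\<bar> powr \<gamma>) * (b * \<bar>t - s\<bar> powr \<gamma>)"
        using st ab by (intro mult_mono hoelder_boundD[OF F] hoelder_boundD[OF g]) auto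
      also have "\<dots> \<le> (a * (t - s) powr \<gamma>) * (b * (t - s) powr \<gamma>)"
        using st ab \<gamma> by (intro mult_mono powr_mono2) auto
      also have "\<dots> = a * b * (t - s) powr (2 * \<gamma>)"
        by (simp add: powr_add[symmetric])
      finally have 1: "norm ((F \<xi> - F s) *v (g t - g s)) \<le> a * b * (t - s) powr (2 * \<gamma>)" .
      have eq: "F \<xi> *v (g t - g s) - (J t - J s)
          = (F \<xi> - F s) *v (g t - g s) - (J t - J s - F s *v (g t - g s))"
        by (simp add: matrix_vector_mult_diff_rdistrib)
      have "norm (F \<xi> *v (g t - g s) - (J t - J s))
          \<le> a * b * (t - s) powr (2 * \<gamma>) + c * (t - s) powr (2 * \<gamma>)"
        unfolding eq using 1 J[of s t] st
          norm_triangle_ineq4[of "(F \<xi> - F s) *v (g t - g s)" "J t - J s - F s *v (g t - g s)"]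
        by linarith
      also have "\<dots> = (c + a * b) * (t - s) powr (2 * \<gamma>)" by (simp add: distrib_right)
      also have "\<dots> \<le> K * (t - s) powr (2 * \<gamma>)"
        by (intro mult_right_mono) (auto simp: K_def)
      also have "(t - s) powr (2 * \<gamma>) = (t - s) powr (2 * \<gamma> - 1) * (t - s)"
        using w by (cases "t = s") (simp_all add: powr_diff)
      also have "K * \<dots> \<le> K * (\<delta> powr (2 * \<gamma> - 1) * (t - s))"
        using K w \<gamma> by (intro mult_left_mono mult_right_mono powr_mono2) auto
      also have "\<dots> = \<epsilon> / 2 * (t - s)" using K by (simp add: \<delta>)
      finally show ?thesis by (simp add: ends)
    qed
    have "(\<Sum>(\<xi>, k)\<in>p. F \<xi> *v (g (Sup k) - g (Inf k))) - (J 1 - J 0)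
        = (\<Sum>(\<xi>, k)\<in>p. F \<xi> *v (g (Sup k) - g (Inf k)) - (J (Sup k) - J (Inf k)))"
      by (simp add: tel[symmetric] sum_subtractf[symmetric] case_prod_beta)
    also have "norm \<dots> \<le> (\<Sum>(\<xi>, k)\<in>p. \<epsilon> / 2 * (Sup k - Inf k))"
      using cell by (intro sum_norm_le) auto
    also have "\<dots> = \<epsilon> / 2 * (\<Sum>(\<xi>, k)\<in>p. Sup k - Inf k)"
      by (simp add: sum_distrib_left case_prod_beta)
    also have "\<dots> = \<epsilon> / 2" by (simp add: len)
    also have "\<dots> < \<epsilon>" using \<open>\<epsilon> > 0\<close> by simp
    finally show "norm ((\<Sum>(\<xi>, k)\<in>p. F \<xi> *v (g (Sup k) - g (Inf k))) - (J 1 - J 0)) < \<epsilon>" .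
  qed
qed

lemma young_integral_eq: "has_young_integral F g I a b \<Longrightarrow> young_integral F g a b = I"
  unfolding young_integral_def using has_young_integral_unique by blast

lemma young_loeve:
  fixes F :: "real \<Rightarrow> real^'n^'m" and g :: "real \<Rightarrow> real^'n"
  assumes \<gamma>: "\<gamma> > 1/2" and F: "hoelder_bound \<gamma> a F" and g: "hoelder_bound \<gamma> b g"
  shows has_young_integral_integral: "has_young_integral F g (young_integral F g 0 1) 0 1"
    and norm_young_integral_le: "norm (young_integral F g 0 1 - F 0 *v (g 1 - g 0)) \<le> young_const \<gamma> * (a * b)"
proof -
  obtain J where J: "\<And>s t. 0 \<le> s \<Longrightarrow> s \<le> t \<Longrightarrow> t \<le> 1 \<Longrightarrow>
      norm (J t - J s - F s *v (g t - g s)) \<le> young_const \<gamma> * (a * b) * (t - s) powr (2 * \<gamma>)"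
    using young_primitive[OF \<gamma> F g] by blast
  have I: "has_young_integral F g (J 1 - J 0) 0 1"
    by (rule has_young_integral_primitive[OF \<gamma> F g J])
  then show "has_young_integral F g (young_integral F g 0 1) 0 1"
    by (simp add: young_integral_eq)
  show "norm (young_integral F g 0 1 - F 0 *v (g 1 - g 0)) \<le> young_const \<gamma> * (a * b)"
    using J[of 0 1] by (simp add: young_integral_eq[OF I])
qed

text \<open>
  Covers linearity in the integrand and in the integrator at once.
\<close>
lemma has_young_integral_combine:
  assumes 1: "has_young_integral F g I a b" and 2: "has_young_integral F' g' I' a b"
    and eq: "\<And>\<xi> s t. G \<xi> *v (h t - h s) = F \<xi> *v (g t - g s) - F' \<xi> *v (g' t - g' s)"
  shows "has_young_integral G h (I - I') a b"
  unfolding has_young_integral_def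
proof (intro allI impI)
  fix \<epsilon> :: real assume "\<epsilon> > 0"
  then have "\<epsilon> / 2 > 0" by simp
  from 1[unfolded has_young_integral_def, rule_format, OF this] obtain d where
    d: "d > 0" "\<And>p. p tagged_division_of {a..b} \<Longrightarrow> (\<forall>(\<xi>, k)\<in>p. Sup k - Inf k < d) \<Longrightarrow>
      norm ((\<Sum>(\<xi>, k)\<in>p. F \<xi> *v (g (Sup k) - g (Inf k))) - I) < \<epsilon> / 2" by blast
  from 2[unfolded has_young_integral_def, rule_format, OF \<open>\<epsilon> / 2 > 0\<close>] obtain d' where
    d': "d' > 0" "\<And>p. p tagged_division_of {a..b} \<Longrightarrow> (\<forall>(\<xi>, k)\<in>p. Sup k - Inf k < d') \<Longrightarrow>
      norm ((\<Sum>(\<xi>, k)\<in>p. F' \<xi> *v (g' (Sup k) - g' (Inf k))) - I') < \<epsilon> / 2" by blast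
  show "\<exists>\<delta>>0. \<forall>p. p tagged_division_of {a..b} \<and> (\<forall>(\<xi>, k)\<in>p. Sup k - Inf k < \<delta>) \<longrightarrow>
      norm ((\<Sum>(\<xi>, k)\<in>p. G \<xi> *v (h (Sup k) - h (Inf k))) - (I - I')) < \<epsilon>"
  proof (intro exI[of _ "min d d'"] conjI allI impI, goal_cases)
    case 1
    then show ?case using d(1) d'(1) by simp
  next
    case (2 p)
    let ?S = "\<Sum>(\<xi>, k)\<in>p. F \<xi> *v (g (Sup k) - g (Inf k))"
    let ?S' = "\<Sum>(\<xi>, k)\<in>p. F' \<xi> *v (g' (Sup k) - g' (Inf k))"
    have "\<forall>(\<xi>, k)\<in>p. Sup k - Inf k < d" "\<forall>(\<xi>, k)\<in>p. Sup k - Inf k < d'"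
      using 2 by fastforce+
    then have "norm (?S - I) < \<epsilon> / 2" "norm (?S' - I') < \<epsilon> / 2"
      using 2 d(2) d'(2) by blast+
    moreover have eq: "(\<Sum>(\<xi>, k)\<in>p. G \<xi> *v (h (Sup k) - h (Inf k))) - (I - I') = (?S - I) - (?S' - I')"
      by (simp add: eq sum_subtractf case_prod_beta)
    ultimately show ?case
      unfolding eq using norm_triangle_ineq4[of "?S - I" "?S' - I'"] by linarith
  qed
qed

lemma young_integral_diff_integrand:
  fixes F F' :: "real \<Rightarrow> real^'n^'m" and g :: "real \<Rightarrow> real^'n"
  assumes "\<gamma> > 1/2" "hoelder_bound \<gamma> a F" "hoelder_bound \<gamma> a' F'" "hoelder_bound \<gamma> b g"
  shows "young_integral F g 0 1 - young_integral F' g 0 1 = young_integral (\<lambda>\<xi>. F \<xi> - F' \<xi>) g 0 1"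
  by (rule young_integral_eq[symmetric],
      rule has_young_integral_combine[OF has_young_integral_integral has_young_integral_integral])
    (use assms in \<open>auto simp: matrix_vector_mult_diff_rdistrib\<close>)

lemma young_integral_diff_integrator:
  fixes F :: "real \<Rightarrow> real^'n^'m" and g g' :: "real \<Rightarrow> real^'n"
  assumes "\<gamma> > 1/2" "hoelder_bound \<gamma> a F" "hoelder_bound \<gamma> b g" "hoelder_bound \<gamma> b' g'"
  shows "young_integral F g 0 1 - young_integral F g' 0 1 = young_integral F (\<lambda>\<xi>. g \<xi> - g' \<xi>) 0 1"
  by (rule young_integral_eq[symmetric],
      rule has_young_integral_combine[OF has_young_integral_integral has_young_integral_integral])
    (use assms in \<open>auto simp: matrix_vector_mult_diff_distrib\<close>)

text \<open>
  For a closed integrator the boundary term \<open>F 0 *v (g 1 - g 0)\<close> vanishes, so that only the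
  oscillation of \<open>F\<close> counts.
\<close>
lemma norm_closed_young_integral_le:
  fixes F :: "real \<Rightarrow> real^'n^'m" and g :: "real \<Rightarrow> real^'n"
  assumes "\<gamma> > 1/2" "hoelder_bound \<gamma> a F" "hoelder_bound \<gamma> b g" "g 1 = g 0"
  shows "norm (young_integral F g 0 1) \<le> young_const \<gamma> * (a * b)"
  using norm_young_integral_le[OF assms(1-3)] assms(4) by simp

section \<open>Finite differences and derivatives\<close>

text \<open>
  The directions form a list so that one induction bounds the differences of all orders.
\<close>
primrec increment :: "'a list \<Rightarrow> ('a::plus \<Rightarrow> 'b::minus) \<Rightarrow> 'a \<Rightarrow> 'b" where
  "increment [] f x = f x"
| "increment (h # hs) f x = increment hs f (x + h) - increment hs f x"

abbreviation pderivative :: "(real^'n \<Rightarrow> real) \<Rightarrow> 'n \<Rightarrow> real^'n \<Rightarrow> real" where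
  "pderivative f i x \<equiv> frechet_derivative f (at x) (axis i 1)"

lemma increment_bounded_pderivative:
  fixes f :: "real^'n \<Rightarrow> real"
  assumes f: "\<And>x. f differentiable (at x)" and B: "\<And>x i. \<bar>pderivative f i x\<bar> \<le> B"
  shows "\<bar>f (x + h) - f x\<bar> \<le> real CARD('n) * B * norm h"
proof -
  have "norm (f (x + h) - f x) \<le> real CARD('n) * B * norm (x + h - x)"
  proof (rule differentiable_bound[of UNIV])
    fix y :: "real^'n"
    show "(f has_derivative frechet_derivative f (at y)) (at y within UNIV)"
      using f[of y] by (simp add: frechet_derivative_works)
    show "onorm (frechet_derivative f (at y)) \<le> real CARD('n) * B"
    proof (rule onorm_le)
      fix v :: "real^'n"
      have lin: "linear (frechet_derivative f (at y))"
        by (rule linear_frechet_derivative[OF f])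
      have "frechet_derivative f (at y) v = frechet_derivative f (at y) (\<Sum>i\<in>UNIV. v $ i *\<^sub>R axis i 1)"
        using basis_expansion[of v] by (simp add: scalar_mult_eq_scaleR)
      also have "\<dots> = (\<Sum>i\<in>UNIV. v $ i *\<^sub>R pderivative f i y)"
        by (simp add: linear_sum[OF lin] linear_cmul[OF lin])
      also have "norm \<dots> \<le> (\<Sum>i\<in>(UNIV::'n set). norm v * B)"
        using B norm_ge_zero by (intro sum_norm_le) (auto simp: abs_mult intro!: mult_mono component_le_norm_cart)
      finally show "norm (frechet_derivative f (at y) v) \<le> real CARD('n) * B * norm v"
        by (simp add: mult_ac)
    qed
  qed auto
  then show ?thesis by simp
qed

text \<open>
  Translations commute with derivatives, hence so do increments.
\<close>
lemma increment_differentiable: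
  fixes f :: "real^'n \<Rightarrow> real"
  assumes f: "\<And>x. f differentiable (at x)"
  shows "increment hs f differentiable (at x)"
    and "pderivative (increment hs f) i x = increment hs (pderivative f i) x"
proof -
  have "(increment hs f has_derivative (\<lambda>v. increment hs (\<lambda>y. frechet_derivative f (at y) v) x)) (at x)"
  proof (induction hs arbitrary: x)
    case Nil
    show ?case using f[of x] by (simp add: frechet_derivative_works)
  next
    case (Cons h hs)
    have "((\<lambda>y. increment hs f (y + h)) has_derivative
        (\<lambda>v. increment hs (\<lambda>y. frechet_derivative f (at y) v) (x + h))) (at x)"
    proof -
      have "((\<lambda>y. y + h) has_derivative (\<lambda>v. v)) (at x)" by (auto intro!: derivative_eq_intros)
      from has_derivative_compose[OF this Cons[of "x + h"]] show ?thesis .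
    qed
    then show ?case using Cons[of x] by (auto intro!: derivative_eq_intros)
  qed
  then show "increment hs f differentiable (at x)"
    and "pderivative (increment hs f) i x = increment hs (pderivative f i) x"
    by (auto simp: differentiable_def frechet_derivative_at[symmetric])
qed

text \<open>
  By induction on the directions: the partial derivatives of the increment along \<open>hs\<close> are
  increments along \<open>hs\<close> of components of the next gradient, so the mean value inequality in the
  direction \<open>h\<close> reduces the bound for \<open>h # hs\<close> to that for \<open>hs\<close> one order higher. Each use of
  the mean value inequality costs a factor \<open>3\<close>, the dimension.
\<close>
lemma increment_tensor_le:
  fixes \<phi> :: "real^3 \<Rightarrow> tensor"
  assumes diff: "\<And>j is x. j < k + length hs \<Longrightarrow> length is = m + j \<Longrightarrow>
      (\<lambda>y. (grad ^^ j) \<phi> y is) differentiable (at x)"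
    and B: "\<And>is x. length is = m + (k + length hs) \<Longrightarrow> \<bar>(grad ^^ (k + length hs)) \<phi> x is\<bar> \<le> B"
    and "length is = m + k"
  shows "\<bar>increment hs (\<lambda>y. (grad ^^ k) \<phi> y is) x\<bar> \<le> 3 ^ length hs * B * prod_list (map norm hs)"
  using assms
proof (induction hs arbitrary: k "is" x)
  case Nil
  then show ?case by simp
next
  case (Cons h hs)
  let ?f = "\<lambda>y. (grad ^^ k) \<phi> y is"
  have diff: "?f differentiable (at y)" for y using Cons.prems by simp
  have "\<bar>pderivative (increment hs ?f) i y\<bar> \<le> 3 ^ length hs * B * prod_list (map norm hs)" for i y
  proof -
    have "pderivative ?f i = (\<lambda>y. (grad ^^ Suc k) \<phi> y (i # is))"
      by (simp add: grad_def[abs_def])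
    then have "pderivative (increment hs ?f) i y = increment hs (\<lambda>y. (grad ^^ Suc k) \<phi> y (i # is)) y"
      using increment_differentiable(2)[where f = ?f and hs = hs and i = i and x = y, OF diff] by simp
    moreover have "\<bar>\<dots>\<bar> \<le> 3 ^ length hs * B * prod_list (map norm hs)"
      by (rule Cons.IH) (use Cons.prems in \<open>auto simp del: funpow.simps\<close>)
    ultimately show ?thesis by simp
  qed
  from increment_bounded_pderivative[OF increment_differentiable(1)[of ?f, OF diff] this]
  show ?case by (simp add: mult_ac)
qed

lemma increment_vec_nth: "increment hs f x $ i = increment hs (\<lambda>y. f y $ i) x"
  for f :: "'a::plus \<Rightarrow> ('b::ab_group_add)^'n"
  by (induction hs arbitrary: x) simp_all

lemma norm_matrix_le:
  fixes M :: "real^'n^'m"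
  assumes "\<And>i j. \<bar>M $ i $ j\<bar> \<le> B"
  shows "norm M \<le> real CARD('m) * (real CARD('n) * B)"
proof -
  have "norm M \<le> (\<Sum>i\<in>UNIV. norm (M $ i))" by (simp add: norm_vec_def[of M] L2_set_le_sum)
  also have "\<dots> \<le> (\<Sum>i\<in>(UNIV::'m set). real CARD('n) * B)"
  proof (rule sum_mono)
    fix i
    have "norm (M $ i) \<le> (\<Sum>j\<in>UNIV. \<bar>M $ i $ j\<bar>)" by (rule norm_le_l1_cart)
    also have "\<dots> \<le> (\<Sum>j\<in>(UNIV::'n set). B)" using assms by (intro sum_mono) auto
    finally show "norm (M $ i) \<le> real CARD('n) * B" by simp
  qed
  finally show ?thesis by simp
qed

lemma abs_component_le_field_norm:
  assumes "field_norm n m \<phi> < \<infinity>" "k \<le> n" "length is = m + k"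
  shows "\<bar>(grad ^^ k) \<phi> x is\<bar> \<le> enn2real (field_norm n m \<phi>)"
proof -
  have "finite {is :: 3 list. length is = m + k}"
    using finite_lists_length_eq[of "UNIV :: 3 set" "m + k"] by simp
  then have "\<bar>(grad ^^ k) \<phi> x is\<bar> \<le> tensor_norm (m + k) ((grad ^^ k) \<phi> x)"
    unfolding tensor_norm_def using assms(3) by (intro member_le_sum) auto
  then have "ennreal \<bar>(grad ^^ k) \<phi> x is\<bar> \<le> ennreal (tensor_norm (m + k) ((grad ^^ k) \<phi> x))"
    by (rule ennreal_leI)
  also have "\<dots> \<le> field_sup_norm (m + k) ((grad ^^ k) \<phi>)"
    unfolding field_sup_norm_def by (rule SUP_upper) simp
  also have "\<dots> \<le> field_norm n m \<phi>"
    unfolding field_norm_def using assms(2) by (intro member_le_sum) auto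
  finally have "ennreal \<bar>(grad ^^ k) \<phi> x is\<bar> \<le> field_norm n m \<phi>" .
  then show ?thesis using assms(1) enn2real_mono[of _ "field_norm n m \<phi>"] by fastforce
qed

lemma field_norm_mono: "n \<le> n' \<Longrightarrow> field_norm n m \<phi> \<le> field_norm n' m \<phi>"
  unfolding field_norm_def by (rule sum_mono2) auto

text \<open>
  An increment of order \<open>j\<close> is controlled by the gradient of order \<open>j\<close> of \<open>A\<close>, which is
  the gradient of order \<open>j - 1\<close> of \<open>\<nabla>A\<close>; this is why at least one direction is required. The factor
  \<open>9\<close> counts the entries of the matrix.
\<close>
lemma increment_matrix_field_le:
  fixes A :: "real^3 \<Rightarrow> real^3^3"
  assumes diff: "field_differentiable_upto n 2 (matrix_field A)" and "length hs \<le> n"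
    and fin: "field_norm p 3 (grad (matrix_field A)) < \<infinity>"
    and hs: "hs \<noteq> []" "length hs \<le> Suc p"
  shows "norm (increment hs A x)
     \<le> 9 * 3 ^ length hs * enn2real (field_norm p 3 (grad (matrix_field A))) * prod_list (map norm hs)"
proof -
  let ?N = "enn2real (field_norm p 3 (grad (matrix_field A)))"
  have "\<bar>increment hs A x $ i $ j\<bar> \<le> 3 ^ length hs * ?N * prod_list (map norm hs)" for i j
  proof -
    have "increment hs A x $ i $ j = increment hs (\<lambda>y. (grad ^^ 0) (matrix_field A) y [i, j]) x"
      by (simp add: increment_vec_nth matrix_field_def)
    moreover have "\<bar>\<dots>\<bar> \<le> 3 ^ length hs * ?N * prod_list (map norm hs)"
    proof (rule increment_tensor_le)
      show "(\<lambda>y. (grad ^^ j) (matrix_field A) y is) differentiable (at x)"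
        if "j < 0 + length hs" "length is = 2 + j" for j "is" x
        using diff that assms(2) by (auto simp: field_differentiable_upto_def)
      show "\<bar>(grad ^^ (0 + length hs)) (matrix_field A) x is\<bar> \<le> ?N"
        if "length is = 2 + (0 + length hs)" for "is" x
      proof -
        obtain k where k: "length hs = Suc k" using hs(1) by (cases hs) auto
        have "\<bar>(grad ^^ k) (grad (matrix_field A)) x is\<bar> \<le> ?N"
          by (rule abs_component_le_field_norm[OF fin]) (use k hs that in auto)
        then show ?thesis by (simp add: k funpow_swap1)
      qed
    qed simp
    ultimately show ?thesis by simp
  qed
  then have "norm (increment hs A x) \<le> real CARD(3) * (real CARD(3) * (3 ^ length hs * ?N * prod_list (map norm hs)))"
    by (rule norm_matrix_le)
  then show ?thesis by simp
qed

section \<open>Balls for the Hoelder norm\<close>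

text \<open>
  The ball of radius \<open>a\<close> for the maximum of the supremum norm and the Hoelder seminorm. This is
  equivalent to the sum of the two (\<open>hoelder_norm_le\<close>, \<open>hoelder_ball_of_norm\<close>), and every estimate is
  then a pair of pointwise inequalities with one constant.
\<close>
definition hoelder_ball :: "real \<Rightarrow> real \<Rightarrow> (real \<Rightarrow> 'a::real_normed_vector) \<Rightarrow> bool" where
  "hoelder_ball \<gamma> a f \<longleftrightarrow> (\<forall>\<xi>\<in>{0..1}. norm (f \<xi>) \<le> a) \<and> hoelder_bound \<gamma> a f"

lemma hoelder_ballD:
  assumes "hoelder_ball \<gamma> a f" "\<xi> \<in> {0..1}"
  shows "norm (f \<xi>) \<le> a"
    and "\<eta> \<in> {0..1} \<Longrightarrow> norm (f \<xi> - f \<eta>) \<le> a * \<bar>\<xi> - \<eta>\<bar> powr \<gamma>"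
  using assms by (auto simp: hoelder_ball_def hoelder_bound_def)

lemma hoelder_ballI:
  assumes "\<And>\<xi>. \<xi> \<in> {0..1} \<Longrightarrow> norm (f \<xi>) \<le> a"
    and "\<And>\<xi> \<eta>. \<xi> \<in> {0..1} \<Longrightarrow> \<eta> \<in> {0..1} \<Longrightarrow> norm (f \<xi> - f \<eta>) \<le> a * \<bar>\<xi> - \<eta>\<bar> powr \<gamma>"
  shows "hoelder_ball \<gamma> a f"
  using assms by (auto simp: hoelder_ball_def hoelder_bound_def)

lemma hoelder_ball_bound: "hoelder_ball \<gamma> a f \<Longrightarrow> hoelder_bound \<gamma> a f"
  by (simp add: hoelder_ball_def)

lemma hoelder_ball_nonneg: "hoelder_ball \<gamma> a f \<Longrightarrow> a \<ge> 0"
  using hoelder_ball_bound hoelder_bound_nonneg by blast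

lemma hoelder_ball_mono: "hoelder_ball \<gamma> a f \<Longrightarrow> a \<le> b \<Longrightarrow> hoelder_ball \<gamma> b f"
  unfolding hoelder_ball_def hoelder_bound_def
  by (meson mult_right_mono order_trans powr_ge_zero)

lemma hoelder_ball_add:
  assumes "hoelder_ball \<gamma> a f" "hoelder_ball \<gamma> b g"
  shows "hoelder_ball \<gamma> (a + b) (\<lambda>\<xi>. f \<xi> + g \<xi>)"
proof (rule hoelder_ballI)
  fix \<xi> :: real assume \<xi>: "\<xi> \<in> {0..1}"
  show "norm (f \<xi> + g \<xi>) \<le> a + b"
    using hoelder_ballD(1)[OF assms(1) \<xi>] hoelder_ballD(1)[OF assms(2) \<xi>] by (rule norm_triangle_mono)
  fix \<eta> :: real assume \<eta>: "\<eta> \<in> {0..1}"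
  have "norm ((f \<xi> - f \<eta>) + (g \<xi> - g \<eta>)) \<le> a * \<bar>\<xi> - \<eta>\<bar> powr \<gamma> + b * \<bar>\<xi> - \<eta>\<bar> powr \<gamma>"
    using hoelder_ballD(2)[OF assms(1) \<xi> \<eta>] hoelder_ballD(2)[OF assms(2) \<xi> \<eta>] by (rule norm_triangle_mono)
  then show "norm (f \<xi> + g \<xi> - (f \<eta> + g \<eta>)) \<le> (a + b) * \<bar>\<xi> - \<eta>\<bar> powr \<gamma>"
    by (simp add: algebra_simps)
qed

lemma hoelder_ball_minus: "hoelder_ball \<gamma> a f \<Longrightarrow> hoelder_ball \<gamma> a (\<lambda>\<xi>. - f \<xi>)"
  unfolding hoelder_ball_def hoelder_bound_def by (simp add: norm_minus_commute)

lemma hoelder_ball_diff: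
  assumes "hoelder_ball \<gamma> a f" "hoelder_ball \<gamma> b g"
  shows "hoelder_ball \<gamma> (a + b) (\<lambda>\<xi>. f \<xi> - g \<xi>)"
  using hoelder_ball_add[OF assms(1) hoelder_ball_minus[OF assms(2)]] by simp

lemma hoelder_ball_cong: "(\<And>\<xi>. \<xi> \<in> {0..1} \<Longrightarrow> f \<xi> = g \<xi>) \<Longrightarrow> hoelder_ball \<gamma> a f \<longleftrightarrow> hoelder_ball \<gamma> a g"
  by (simp add: hoelder_ball_def hoelder_bound_def)

lemma hoelder_ball_limit:
  assumes "\<And>n. hoelder_ball \<gamma> (a n) (f n)" "a \<longlonglongrightarrow> b"
    and lim: "\<And>\<xi>. \<xi> \<in> {0..1} \<Longrightarrow> (\<lambda>n. f n \<xi>) \<longlonglongrightarrow> g \<xi>"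
  shows "hoelder_ball \<gamma> b g"
proof (rule hoelder_ballI)
  fix \<xi> :: real assume \<xi>: "\<xi> \<in> {0..1}"
  show "norm (g \<xi>) \<le> b"
    by (rule LIMSEQ_le[OF tendsto_norm[OF lim[OF \<xi>]] assms(2)]) (use hoelder_ballD(1)[OF assms(1) \<xi>] in blast)
  fix \<eta> :: real assume \<eta>: "\<eta> \<in> {0..1}"
  show "norm (g \<xi> - g \<eta>) \<le> b * \<bar>\<xi> - \<eta>\<bar> powr \<gamma>"
    by (rule LIMSEQ_le[OF tendsto_norm[OF tendsto_diff[OF lim[OF \<xi>] lim[OF \<eta>]]] tendsto_mult_right[OF assms(2)]])
      (use hoelder_ballD(2)[OF assms(1) \<xi> \<eta>] in blast)
qed

lemma hoelder_norm_le:
  assumes f: "hoelder_ball \<gamma> a f"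
  shows "hoelder_norm \<gamma> f \<le> ennreal (2 * a)"
proof -
  have a: "a \<ge> 0" using f by (rule hoelder_ball_nonneg)
  have "curve_sup_norm f \<le> ennreal a"
    unfolding curve_sup_norm_def using hoelder_ballD(1)[OF f] by (intro SUP_least ennreal_leI)
  moreover have "hoelder_seminorm \<gamma> f \<le> ennreal a"
    unfolding hoelder_seminorm_def
  proof (rule SUP_least, clarify, rule ennreal_leI)
    fix \<xi> \<eta> :: real assume "\<xi> \<in> {0..1}" "\<eta> \<in> {0..1}" "\<xi> \<noteq> \<eta>"
    then show "norm (f \<xi> - f \<eta>) / \<bar>\<xi> - \<eta>\<bar> powr \<gamma> \<le> a"
      using hoelder_ballD(2)[OF f] by (simp add: divide_le_eq)
  qed
  ultimately have "hoelder_norm \<gamma> f \<le> ennreal a + ennreal a"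
    unfolding hoelder_norm_def by (rule add_mono)
  then show ?thesis using a by (simp add: ennreal_plus[symmetric] del: ennreal_plus)
qed

lemma hoelder_ball_of_norm:
  assumes f: "hoelder_norm \<gamma> f \<le> ennreal a" and a: "a \<ge> 0"
  shows "hoelder_ball \<gamma> a f"
proof (rule hoelder_ballI)
  have norms: "curve_sup_norm f \<le> ennreal a" "hoelder_seminorm \<gamma> f \<le> ennreal a"
    using f unfolding hoelder_norm_def
    by (auto elim!: order_trans[rotated] intro: add_increasing add_increasing2)
  fix \<xi> :: real assume \<xi>: "\<xi> \<in> {0..1}"
  have "ennreal (norm (f \<xi>)) \<le> curve_sup_norm f"
    unfolding curve_sup_norm_def by (rule SUP_upper[OF \<xi>])
  then show "norm (f \<xi>) \<le> a" using norms(1) a by (meson ennreal_le_iff order_trans)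
  fix \<eta> :: real assume \<eta>: "\<eta> \<in> {0..1}"
  show "norm (f \<xi> - f \<eta>) \<le> a * \<bar>\<xi> - \<eta>\<bar> powr \<gamma>"
  proof (cases "\<xi> = \<eta>")
    case False
    have "ennreal (norm (f \<xi> - f \<eta>) / \<bar>\<xi> - \<eta>\<bar> powr \<gamma>) \<le> hoelder_seminorm \<gamma> f"
      unfolding hoelder_seminorm_def
      using \<xi> \<eta> False by (intro SUP_upper2[of "(\<xi>, \<eta>)"]) auto
    then have "norm (f \<xi> - f \<eta>) / \<bar>\<xi> - \<eta>\<bar> powr \<gamma> \<le> a"
      using norms(2) a by (meson ennreal_le_iff order_trans)
    then show ?thesis using False by (simp add: divide_le_eq)
  qed simp
qed

lemma hoelder_ball_hoelder_curve:
  "X \<in> hoelder_curves \<gamma> \<Longrightarrow> hoelder_ball \<gamma> (enn2real (hoelder_norm \<gamma> X)) X"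
  by (rule hoelder_ball_of_norm) (auto simp: hoelder_curves_def less_top)

lemma hoelder_curve_closed: "X \<in> hoelder_curves \<gamma> \<Longrightarrow> X 1 = X 0"
  by (auto simp: hoelder_curves_def closed_curves_def pathfinish_def pathstart_def)

lemma hoelder_bound_continuous_on:
  assumes "\<gamma> > 0" "hoelder_bound \<gamma> a f"
  shows "continuous_on {0..1} f"
  unfolding continuous_on_def
proof
  fix \<eta> :: real assume \<eta>: "\<eta> \<in> {0..1}"
  have "((\<lambda>\<xi>. a * \<bar>\<xi> - \<eta>\<bar> powr \<gamma>) \<longlongrightarrow> a * \<bar>\<eta> - \<eta>\<bar> powr \<gamma>) (at \<eta> within {0..1})"
    using assms(1) by (intro tendsto_intros) auto
  then have "((\<lambda>\<xi>. a * \<bar>\<xi> - \<eta>\<bar> powr \<gamma>) \<longlongrightarrow> 0) (at \<eta> within {0..1})" by simp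
  then have "((\<lambda>\<xi>. f \<xi> - f \<eta>) \<longlongrightarrow> 0) (at \<eta> within {0..1})"
    by (rule Lim_null_comparison[rotated])
      (use hoelder_boundD[OF assms(2)] \<eta> in \<open>auto simp: eventually_at_filter\<close>)
  then show "(f \<longlongrightarrow> f \<eta>) (at \<eta> within {0..1})" by (rule LIM_zero_cancel)
qed

lemma hoelder_ball_in_hoelder_curves:
  assumes "\<gamma> > 0" "hoelder_ball \<gamma> a f" "f 1 = f 0"
  shows "f \<in> hoelder_curves \<gamma>"
proof -
  have "hoelder_norm \<gamma> f < \<infinity>"
    using hoelder_norm_le[OF assms(2)] by (simp add: le_less_trans)
  then show ?thesis
    using hoelder_bound_continuous_on[OF assms(1) hoelder_ball_bound[OF assms(2)]] assms(3)
    by (simp add: hoelder_curves_def closed_curves_def path_def pathfinish_def pathstart_def)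
qed

text \<open>
  A path that is continuous in the Hoelder norm is bounded near every time, hence on the compact
  time interval.
\<close>
lemma continuous_hoelder_paths_bounded:
  assumes Y: "Y \<in> continuous_hoelder_paths T \<gamma>" and "T \<ge> 0"
  obtains R where "\<And>t. t \<in> {0..T} \<Longrightarrow> hoelder_ball \<gamma> R (Y t)"
proof -
  define bounded_on where "bounded_on a b \<longleftrightarrow> (\<exists>R. \<forall>t\<in>{a..b} \<inter> {0..T}. hoelder_ball \<gamma> R (Y t))" for a b
  have "bounded_on 0 T"
    using \<open>T \<ge> 0\<close>
  proof (induction rule: Bolzano[where P = bounded_on])
    case (trans a b c)
    then obtain R R' where R: "\<forall>t\<in>{a..b} \<inter> {0..T}. hoelder_ball \<gamma> R (Y t)"
        "\<forall>t\<in>{b..c} \<inter> {0..T}. hoelder_ball \<gamma> R' (Y t)"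
      unfolding bounded_on_def by blast
    have "hoelder_ball \<gamma> (max R R') (Y t)" if "t \<in> {a..c} \<inter> {0..T}" for t
    proof (cases "t \<le> b")
      case True
      then show ?thesis using R(1) that by (auto intro: hoelder_ball_mono[of \<gamma> R])
    next
      case False
      then show ?thesis using R(2) that by (auto intro: hoelder_ball_mono[of \<gamma> R'])
    qed
    then show ?case unfolding bounded_on_def by blast
  next
    case (local x)
    then have x: "0 \<le> x" "x \<le> T" .
    define R where "R = enn2real (hoelder_norm \<gamma> (Y x))"
    have R: "hoelder_ball \<gamma> R (Y x)"
      using Y x by (auto simp: R_def continuous_hoelder_paths_def intro!: hoelder_ball_hoelder_curve)
    have "((\<lambda>s. hoelder_norm \<gamma> (\<lambda>\<xi>. Y s \<xi> - Y x \<xi>)) \<longlongrightarrow> 0) (at x within {0..T})"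
      using Y x by (auto simp: continuous_hoelder_paths_def)
    then have "eventually (\<lambda>s. hoelder_norm \<gamma> (\<lambda>\<xi>. Y s \<xi> - Y x \<xi>) < 1) (at x within {0..T})"
      by (rule order_tendstoD) simp
    then obtain d where d: "d > 0" "\<And>s. s \<in> {0..T} \<Longrightarrow> s \<noteq> x \<Longrightarrow> dist s x < d \<Longrightarrow>
        hoelder_norm \<gamma> (\<lambda>\<xi>. Y s \<xi> - Y x \<xi>) < 1"
      unfolding eventually_at by blast
    have "hoelder_ball \<gamma> (1 + R) (Y s)" if "s \<in> {0..T}" "dist s x < d" for s
    proof (cases "s = x")
      case True
      then show ?thesis using hoelder_ball_mono[OF R] by simp
    next
      case False
      have "hoelder_ball \<gamma> 1 (\<lambda>\<xi>. Y s \<xi> - Y x \<xi>)"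
        by (rule hoelder_ball_of_norm) (use d(2)[OF that(1) False that(2)] in auto)
      from hoelder_ball_add[OF this R] show ?thesis by simp
    qed
    then have "bounded_on a b" if "a \<le> x" "x \<le> b" "b - a < d" for a b
      unfolding bounded_on_def using that by (intro exI[of _ "1 + R"]) (auto simp: dist_real_def)
    then show ?case using d(1) by blast
  qed
  then obtain R where "\<forall>t\<in>{0..T}. hoelder_ball \<gamma> R (Y t)" unfolding bounded_on_def by auto
  then show thesis by (intro that[of R]) blast
qed

text \<open>
  Minkowski's inequality, in the form in which the norms are replaced by an integrable upper
  bound and their measurability is not an issue.
\<close>
lemma hoelder_ball_integral:
  fixes u :: "real \<Rightarrow> real \<Rightarrow> 'a::euclidean_space"
  assumes u: "\<And>r. r \<in> {s..t} \<Longrightarrow> hoelder_ball \<gamma> (e r) (u r)"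
    and int: "\<And>\<xi>. \<xi> \<in> {0..1} \<Longrightarrow> (\<lambda>r. u r \<xi>) integrable_on {s..t}"
    and e: "(e has_integral E) {s..t}"
  shows "hoelder_ball \<gamma> E (\<lambda>\<xi>. integral {s..t} (\<lambda>r. u r \<xi>))"
proof (rule hoelder_ballI)
  fix \<xi> :: real assume \<xi>: "\<xi> \<in> {0..1}"
  show "norm (integral {s..t} (\<lambda>r. u r \<xi>)) \<le> E"
    using integral_norm_bound_integral[OF int[OF \<xi>] has_integral_integrable[OF e]]
      hoelder_ballD(1)[OF u \<xi>] integral_unique[OF e] by simp
  fix \<eta> :: real assume \<eta>: "\<eta> \<in> {0..1}"
  have e': "((\<lambda>r. e r * \<bar>\<xi> - \<eta>\<bar> powr \<gamma>) has_integral E * \<bar>\<xi> - \<eta>\<bar> powr \<gamma>) {s..t}"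
    using e by (rule has_integral_mult_left)
  have "norm (integral {s..t} (\<lambda>r. u r \<xi> - u r \<eta>)) \<le> integral {s..t} (\<lambda>r. e r * \<bar>\<xi> - \<eta>\<bar> powr \<gamma>)"
    by (intro integral_norm_bound_integral integrable_diff int \<xi> \<eta> has_integral_integrable[OF e'])
      (use hoelder_ballD(2)[OF u \<xi> \<eta>] in auto)
  then show "norm (integral {s..t} (\<lambda>r. u r \<xi>) - integral {s..t} (\<lambda>r. u r \<eta>)) \<le> E * \<bar>\<xi> - \<eta>\<bar> powr \<gamma>"
    unfolding integral_diff[OF int[OF \<xi>] int[OF \<eta>]] integral_unique[OF e'] .
qed

section \<open>The velocity of a curve in its own field\<close>

text \<open>
  All that is used of \<open>A\<close>. The constants are separated because \<open>K\<close>, which bounds the increments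
  of order one and two, may enter the existence time, while \<open>K'\<close> may not.
\<close>
locale hoelder_flow =
  fixes \<gamma> :: real and A :: "real^3 \<Rightarrow> real^3^3" and K K' :: real
  assumes \<gamma>: "\<gamma> > 1/2" and K: "K \<ge> 0" and K': "K' \<ge> 0"
    and increment1: "norm (increment [h] A p) \<le> K * norm h"
    and increment2: "norm (increment [h, k] A p) \<le> K * (norm h * norm k)"
    and increment3: "norm (increment [h, k, l] A p) \<le> K' * (norm h * norm k * norm l)"
begin

text \<open>
  The vector field \<open>U\<close> of the differential equation on the space of curves.
\<close>
definition self_velocity :: "(real \<Rightarrow> real^3) \<Rightarrow> real \<Rightarrow> real^3" where
  "self_velocity Z \<xi> = velocity A Z (Z \<xi>)"

abbreviation "C \<equiv> young_const \<gamma>"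

lemma C_pos: "C > 0" using young_const_pos[OF \<gamma>] .

lemma kernel_hoelder:
  assumes Z: "hoelder_bound \<gamma> R Z"
  shows "hoelder_bound \<gamma> (K * R) (\<lambda>\<eta>. A (x - Z \<eta>))"
  unfolding hoelder_bound_def
proof (intro ballI)
  fix \<eta> \<eta>' :: real assume \<eta>: "\<eta> \<in> {0..1}" "\<eta>' \<in> {0..1}"
  have "A (x - Z \<eta>) - A (x - Z \<eta>') = increment [Z \<eta>' - Z \<eta>] A (x - Z \<eta>')"
    by simp
  then have "norm (A (x - Z \<eta>) - A (x - Z \<eta>')) \<le> K * norm (Z \<eta>' - Z \<eta>)"
    using increment1 by metis
  also have "\<dots> \<le> K * (R * \<bar>\<eta>' - \<eta>\<bar> powr \<gamma>)"
    using K \<eta> by (intro mult_left_mono hoelder_boundD[OF Z]) auto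
  finally show "norm (A (x - Z \<eta>) - A (x - Z \<eta>')) \<le> K * R * \<bar>\<eta> - \<eta>'\<bar> powr \<gamma>"
    by (simp add: abs_minus_commute)
qed

text \<open>
  The mixed difference of \<open>A(x - Z \<eta>)\<close> in \<open>x\<close> and \<open>\<eta>\<close> is an increment of order two.
\<close>
lemma kernel_diff_hoelder:
  assumes Z: "hoelder_bound \<gamma> R Z" and x: "norm (x - x') \<le> r"
  shows "hoelder_bound \<gamma> (K * r * R) (\<lambda>\<eta>. A (x - Z \<eta>) - A (x' - Z \<eta>))"
  unfolding hoelder_bound_def
proof (intro ballI)
  fix \<eta> \<eta>' :: real assume \<eta>: "\<eta> \<in> {0..1}" "\<eta>' \<in> {0..1}"
  have r: "r \<ge> 0" using order_trans[OF norm_ge_zero x] .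
  have "A (x - Z \<eta>) - A (x' - Z \<eta>) - (A (x - Z \<eta>') - A (x' - Z \<eta>'))
      = increment [x - x', Z \<eta>' - Z \<eta>] A (x' - Z \<eta>')"
    by simp
  then have "norm (A (x - Z \<eta>) - A (x' - Z \<eta>) - (A (x - Z \<eta>') - A (x' - Z \<eta>')))
      \<le> K * (norm (x - x') * norm (Z \<eta>' - Z \<eta>))"
    using increment2 by metis
  also have "\<dots> \<le> K * (r * (R * \<bar>\<eta>' - \<eta>\<bar> powr \<gamma>))"
    using K r \<eta> x by (intro mult_left_mono mult_mono hoelder_boundD[OF Z]) auto
  finally show "norm (A (x - Z \<eta>) - A (x' - Z \<eta>) - (A (x - Z \<eta>') - A (x' - Z \<eta>')))
      \<le> K * r * R * \<bar>\<eta> - \<eta>'\<bar> powr \<gamma>"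
    by (simp add: abs_minus_commute mult_ac)
qed

text \<open>
  The increment in \<open>\<eta>\<close> is compared for two base points and two directions. A change of direction
  gives again an increment of order one, a change of base point one of order two, with
  no remainder in either case.
\<close>
lemma kernel_perturbation_hoelder:
  assumes Y: "hoelder_bound \<gamma> R Y" and Z: "hoelder_bound \<gamma> R Z"
    and YZ: "hoelder_ball \<gamma> d (\<lambda>\<xi>. Y \<xi> - Z \<xi>)" and x: "norm (x - z) \<le> d"
  shows "hoelder_bound \<gamma> ((K + 2 * K * R) * d) (\<lambda>\<eta>. A (x - Y \<eta>) - A (z - Z \<eta>))"
  unfolding hoelder_bound_def
proof (intro ballI)
  fix \<eta> \<eta>' :: real assume \<eta>: "\<eta> \<in> {0..1}" "\<eta>' \<in> {0..1}"
  define p q k k' where defs: "p = x - Y \<eta>'" "q = z - Z \<eta>'" "k = Y \<eta>' - Y \<eta>" "k' = Z \<eta>' - Z \<eta>"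
  let ?r = "\<bar>\<eta>' - \<eta>\<bar> powr \<gamma>"
  have d: "d \<ge> 0" using YZ by (rule hoelder_ball_nonneg)
  have "p - q = (x - z) - (Y \<eta>' - Z \<eta>')" by (simp add: defs)
  also have "norm \<dots> \<le> d + d"
    by (rule norm_triangle_le_diff) (use x hoelder_ballD(1)[OF YZ \<eta>(2)] in simp)
  finally have pq: "norm (p - q) \<le> 2 * d" by simp
  have "k - k' = (Y \<eta>' - Z \<eta>') - (Y \<eta> - Z \<eta>)" by (simp add: defs)
  then have kk: "norm (k - k') \<le> d * ?r" using hoelder_ballD(2)[OF YZ \<eta>(2) \<eta>(1)] by simp
  have k': "norm k' \<le> R * ?r" using hoelder_boundD[OF Z \<eta>(2) \<eta>(1)] by (simp add: defs)
  have "A (x - Y \<eta>) - A (z - Z \<eta>) - (A (x - Y \<eta>') - A (z - Z \<eta>'))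
      = increment [k - k'] A (p + k') + increment [p - q, k'] A q"
    by (simp add: defs algebra_simps)
  also have "norm \<dots> \<le> K * norm (k - k') + K * (norm (p - q) * norm k')"
    by (rule norm_triangle_mono[OF increment1 increment2])
  also have "\<dots> \<le> K * (d * ?r) + K * (2 * d * (R * ?r))"
    using kk pq k' K d by (intro add_mono mult_left_mono mult_mono) auto
  finally show "norm (A (x - Y \<eta>) - A (z - Z \<eta>) - (A (x - Y \<eta>') - A (z - Z \<eta>')))
      \<le> (K + 2 * K * R) * d * \<bar>\<eta> - \<eta>'\<bar> powr \<gamma>"
    by (simp add: abs_minus_commute algebra_simps)
qed

text \<open>
  The comparison of two second order increments \<open>[h, k]\<close> at \<open>p\<close> and \<open>[h', k']\<close> at \<open>q\<close>. Exchanging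
  \<open>h\<close>, then \<open>k\<close>, leaves second order increments; exchanging the base point leaves one of order
  three, the only place where \<open>\<nabla>\<^sup>3A\<close> is needed. The parameter \<open>\<tau>\<close> stands for
  \<open>\<bar>\<xi> - \<xi>'\<bar> powr \<gamma>\<close>.
\<close>
lemma kernel_diff_perturbation_hoelder:
  assumes Y: "hoelder_bound \<gamma> R Y" and Z: "hoelder_bound \<gamma> R Z"
    and YZ: "hoelder_ball \<gamma> d (\<lambda>\<xi>. Y \<xi> - Z \<xi>)" and x': "norm (x' - z') \<le> d"
    and hh: "norm ((x - x') - (z - z')) \<le> d * \<tau>" and h': "norm (z - z') \<le> R * \<tau>"
  shows "hoelder_bound \<gamma> ((2 * K * R + 2 * K' * R * R) * d * \<tau>)
    (\<lambda>\<eta>. (A (x - Y \<eta>) - A (x' - Y \<eta>)) - (A (z - Z \<eta>) - A (z' - Z \<eta>)))"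
  unfolding hoelder_bound_def
proof (intro ballI)
  fix \<eta> \<eta>' :: real assume \<eta>: "\<eta> \<in> {0..1}" "\<eta>' \<in> {0..1}"
  define p q h h' k k' where defs: "p = x' - Y \<eta>'" "q = z' - Z \<eta>'" "h = x - x'" "h' = z - z'"
    "k = Y \<eta>' - Y \<eta>" "k' = Z \<eta>' - Z \<eta>"
  let ?r = "\<bar>\<eta>' - \<eta>\<bar> powr \<gamma>"
  have d: "d \<ge> 0" using YZ by (rule hoelder_ball_nonneg)
  have R: "R \<ge> 0" using Y by (rule hoelder_bound_nonneg)
  have "p - q = (x' - z') - (Y \<eta>' - Z \<eta>')" by (simp add: defs)
  also have "norm \<dots> \<le> d + d"
    by (rule norm_triangle_le_diff) (use x' hoelder_ballD(1)[OF YZ \<eta>(2)] in simp)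
  finally have pq: "norm (p - q) \<le> 2 * d" by simp
  have "k - k' = (Y \<eta>' - Z \<eta>') - (Y \<eta> - Z \<eta>)" by (simp add: defs)
  then have kk: "norm (k - k') \<le> d * ?r" using hoelder_ballD(2)[OF YZ \<eta>(2) \<eta>(1)] by simp
  have k: "norm k \<le> R * ?r" using hoelder_boundD[OF Y \<eta>(2) \<eta>(1)] by (simp add: defs)
  have k': "norm k' \<le> R * ?r" using hoelder_boundD[OF Z \<eta>(2) \<eta>(1)] by (simp add: defs)
  have h': "norm h' \<le> R * \<tau>" and hh: "norm (h - h') \<le> d * \<tau>" using h' hh by (simp_all add: defs)
  have R\<tau>: "0 \<le> R * \<tau>" "0 \<le> d * \<tau>" using order_trans[OF norm_ge_zero h'] order_trans[OF norm_ge_zero hh] .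
  let ?D = "(A (x - Y \<eta>) - A (x' - Y \<eta>)) - (A (z - Z \<eta>) - A (z' - Z \<eta>))
      - ((A (x - Y \<eta>') - A (x' - Y \<eta>')) - (A (z - Z \<eta>') - A (z' - Z \<eta>')))"
  have "?D = increment [h - h', k] A (p + h') + increment [h', k - k'] A (p + k')
      + increment [p - q, h', k'] A q"
    by (simp add: defs algebra_simps)
  also have "norm \<dots> \<le> K * (norm (h - h') * norm k) + K * (norm h' * norm (k - k'))
      + K' * (norm (p - q) * norm h' * norm k')"
    by (rule norm_triangle_mono[OF norm_triangle_mono[OF increment2 increment2] increment3])
  also have "\<dots> \<le> K * (d * \<tau> * (R * ?r)) + K * (R * \<tau> * (d * ?r)) + K' * (2 * d * (R * \<tau>) * (R * ?r))"
    using kk pq k k' K K' d hh h' R\<tau> by (intro add_mono mult_left_mono mult_mono) auto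
  finally show "norm ?D \<le> (2 * K * R + 2 * K' * R * R) * d * \<tau> * \<bar>\<eta> - \<eta>'\<bar> powr \<gamma>"
    by (simp add: abs_minus_commute algebra_simps)
qed

lemma velocity_diff:
  assumes "hoelder_bound \<gamma> R Z"
  shows "velocity A Z x - velocity A Z x' = young_integral (\<lambda>\<eta>. A (x - Z \<eta>) - A (x' - Z \<eta>)) Z 0 1"
  unfolding velocity_def
  by (rule young_integral_diff_integrand[OF \<gamma> kernel_hoelder[OF assms] kernel_hoelder[OF assms] assms])

text \<open>
  The two summands bound the supremum norm and the Hoelder seminorm of the velocity of a curve in
  the ball of radius \<open>R\<close>. They contain \<open>K\<close> but not \<open>K'\<close>.
\<close>
definition speed :: "real \<Rightarrow> real" where
  "speed R = C * (K * R * R) + C * (K * R * R * R)"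

lemma speed_nonneg: "R \<ge> 0 \<Longrightarrow> speed R \<ge> 0"
  using C_pos K by (simp add: speed_def)

lemma self_velocity_bounded:
  assumes Z: "hoelder_ball \<gamma> R Z" and closed: "Z 1 = Z 0"
  shows "hoelder_ball \<gamma> (speed R) (self_velocity Z)"
proof (rule hoelder_ballI)
  have Z': "hoelder_bound \<gamma> R Z" using Z by (rule hoelder_ball_bound)
  have R: "R \<ge> 0" using Z by (rule hoelder_ball_nonneg)
  have nonneg: "0 \<le> C * (K * R * R)" "0 \<le> C * (K * R * R * R)"
    using C_pos K R by simp_all
  fix \<xi> :: real assume \<xi>: "\<xi> \<in> {0..1}"
  have "norm (self_velocity Z \<xi>) \<le> C * (K * R * R)"
    unfolding self_velocity_def velocity_def
    by (rule norm_closed_young_integral_le[OF \<gamma> kernel_hoelder[OF Z'] Z' closed])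
  then show "norm (self_velocity Z \<xi>) \<le> speed R" using nonneg by (simp add: speed_def)
  fix \<eta> :: real assume \<eta>: "\<eta> \<in> {0..1}"
  let ?\<tau> = "\<bar>\<xi> - \<eta>\<bar> powr \<gamma>"
  have "norm (self_velocity Z \<xi> - self_velocity Z \<eta>) \<le> C * (K * (R * ?\<tau>) * R * R)"
    unfolding self_velocity_def velocity_diff[OF Z']
    by (rule norm_closed_young_integral_le[OF \<gamma> kernel_diff_hoelder[OF Z' hoelder_boundD[OF Z' \<xi> \<eta>]] Z' closed])
  also have "\<dots> = C * (K * R * R * R) * ?\<tau>" by (simp add: mult_ac)
  also have "\<dots> \<le> speed R * ?\<tau>" using nonneg by (intro mult_right_mono) (simp_all add: speed_def)
  finally show "norm (self_velocity Z \<xi> - self_velocity Z \<eta>) \<le> speed R * ?\<tau>" .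
qed

text \<open>
  The first two summands are for the supremum norm, the next two for the Hoelder seminorm; in each
  pair the first is for a change of the integrand, the second for a change of the integrator. The
  final \<open>1\<close> makes the constant positive.
\<close>
definition lipschitz :: "real \<Rightarrow> real" where
  "lipschitz R = C * ((K + 2 * K * R) * R) + C * (K * R) +
     (C * ((2 * K * R + 2 * K' * R * R) * R) + C * (K * R * R)) + 1"

lemma lipschitz_pos: "R \<ge> 0 \<Longrightarrow> lipschitz R > 0"
  using C_pos K K' by (simp add: lipschitz_def add_nonneg_pos)

text \<open>
  The integrand is exchanged first, then the integrator. In the Hoelder estimate the comparison of
  \<open>\<xi>\<close> with \<open>\<xi>'\<close> is moved under the integral before the curves are compared.
\<close>
lemma self_velocity_lipschitz:
  assumes Y: "hoelder_ball \<gamma> R Y" and Z: "hoelder_ball \<gamma> R Z"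
    and closed: "Y 1 = Y 0" "Z 1 = Z 0" and YZ: "hoelder_ball \<gamma> d (\<lambda>\<xi>. Y \<xi> - Z \<xi>)"
  shows "hoelder_ball \<gamma> (lipschitz R * d) (\<lambda>\<xi>. self_velocity Y \<xi> - self_velocity Z \<xi>)"
proof (rule hoelder_ballI)
  have Y': "hoelder_bound \<gamma> R Y" and Z': "hoelder_bound \<gamma> R Z" and YZ': "hoelder_bound \<gamma> d (\<lambda>\<xi>. Y \<xi> - Z \<xi>)"
    using Y Z YZ by (simp_all add: hoelder_ball_bound)
  have closed': "Y 1 - Z 1 = Y 0 - Z 0" using closed by simp
  have R: "R \<ge> 0" using Z by (rule hoelder_ball_nonneg)
  have d: "d \<ge> 0" using YZ by (rule hoelder_ball_nonneg)
  define L1 where "L1 = C * ((K + 2 * K * R) * R) + C * (K * R)"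
  define L2 where "L2 = C * ((2 * K * R + 2 * K' * R * R) * R) + C * (K * R * R)"
  have L: "0 \<le> L1" "0 \<le> L2" "lipschitz R = L1 + L2 + 1"
    using C_pos K K' R by (simp_all add: L1_def L2_def lipschitz_def)
  fix \<xi> :: real assume \<xi>: "\<xi> \<in> {0..1}"
  have "self_velocity Y \<xi> - self_velocity Z \<xi> =
      (young_integral (\<lambda>\<eta>. A (Y \<xi> - Y \<eta>)) Y 0 1 - young_integral (\<lambda>\<eta>. A (Z \<xi> - Z \<eta>)) Y 0 1) +
      (young_integral (\<lambda>\<eta>. A (Z \<xi> - Z \<eta>)) Y 0 1 - young_integral (\<lambda>\<eta>. A (Z \<xi> - Z \<eta>)) Z 0 1)"
    by (simp add: self_velocity_def velocity_def)
  also have "\<dots> = young_integral (\<lambda>\<eta>. A (Y \<xi> - Y \<eta>) - A (Z \<xi> - Z \<eta>)) Y 0 1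
      + young_integral (\<lambda>\<eta>. A (Z \<xi> - Z \<eta>)) (\<lambda>\<eta>. Y \<eta> - Z \<eta>) 0 1"
    by (simp only: young_integral_diff_integrand[OF \<gamma> kernel_hoelder[OF Y'] kernel_hoelder[OF Z'] Y']
        young_integral_diff_integrator[OF \<gamma> kernel_hoelder[OF Z'] Y' Z'])
  also have "norm \<dots> \<le> C * ((K + 2 * K * R) * d * R) + C * (K * R * d)"
    by (intro norm_triangle_mono norm_closed_young_integral_le[OF \<gamma> _ Y' closed(1)]
        norm_closed_young_integral_le[OF \<gamma> kernel_hoelder[OF Z'] YZ' closed']
        kernel_perturbation_hoelder[OF Y' Z' YZ hoelder_ballD(1)[OF YZ \<xi>]])
  also have "\<dots> = L1 * d" by (simp add: L1_def algebra_simps)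
  also have "\<dots> \<le> lipschitz R * d" using L d by (intro mult_right_mono) auto
  finally show "norm (self_velocity Y \<xi> - self_velocity Z \<xi>) \<le> lipschitz R * d" .
  fix \<xi>' :: real assume \<xi>': "\<xi>' \<in> {0..1}"
  let ?\<tau> = "\<bar>\<xi> - \<xi>'\<bar> powr \<gamma>"
  let ?f = "\<lambda>\<eta>. A (Y \<xi> - Y \<eta>) - A (Y \<xi>' - Y \<eta>)" and ?g = "\<lambda>\<eta>. A (Z \<xi> - Z \<eta>) - A (Z \<xi>' - Z \<eta>)"
  have f: "hoelder_bound \<gamma> (K * (R * ?\<tau>) * R) ?f" and g: "hoelder_bound \<gamma> (K * (R * ?\<tau>) * R) ?g"
    by (rule kernel_diff_hoelder[OF Y' hoelder_boundD[OF Y' \<xi> \<xi>']]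
        kernel_diff_hoelder[OF Z' hoelder_boundD[OF Z' \<xi> \<xi>']])+
  have "self_velocity Y \<xi> - self_velocity Z \<xi> - (self_velocity Y \<xi>' - self_velocity Z \<xi>')
      = (self_velocity Y \<xi> - self_velocity Y \<xi>') - (self_velocity Z \<xi> - self_velocity Z \<xi>')" by simp
  also have "\<dots> = (young_integral ?f Y 0 1 - young_integral ?g Y 0 1)
      + (young_integral ?g Y 0 1 - young_integral ?g Z 0 1)"
    by (simp add: self_velocity_def velocity_diff[OF Y'] velocity_diff[OF Z'])
  also have "\<dots> = young_integral (\<lambda>\<eta>. ?f \<eta> - ?g \<eta>) Y 0 1 + young_integral ?g (\<lambda>\<eta>. Y \<eta> - Z \<eta>) 0 1"
    by (simp only: young_integral_diff_integrand[OF \<gamma> f g Y'] young_integral_diff_integrator[OF \<gamma> g Y' Z'])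
  also have "norm \<dots> \<le> C * ((2 * K * R + 2 * K' * R * R) * d * ?\<tau> * R) + C * (K * (R * ?\<tau>) * R * d)"
  proof (intro norm_triangle_mono norm_closed_young_integral_le[OF \<gamma> _ Y' closed(1)]
      norm_closed_young_integral_le[OF \<gamma> g YZ' closed'] kernel_diff_perturbation_hoelder[OF Y' Z' YZ])
    show "norm (Y \<xi>' - Z \<xi>') \<le> d" by (rule hoelder_ballD(1)[OF YZ \<xi>'])
    show "norm (Z \<xi> - Z \<xi>') \<le> R * ?\<tau>" by (rule hoelder_boundD[OF Z' \<xi> \<xi>'])
    show "norm (Y \<xi> - Y \<xi>' - (Z \<xi> - Z \<xi>')) \<le> d * ?\<tau>"
      using hoelder_boundD[OF YZ' \<xi> \<xi>'] by (simp add: algebra_simps)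
  qed
  also have "\<dots> = L2 * d * ?\<tau>" by (simp add: L2_def algebra_simps)
  also have "\<dots> \<le> lipschitz R * d * ?\<tau>" using L d by (intro mult_right_mono) auto
  finally show "norm (self_velocity Y \<xi> - self_velocity Z \<xi> - (self_velocity Y \<xi>' - self_velocity Z \<xi>'))
      \<le> lipschitz R * d * ?\<tau>" .
qed

section \<open>Picard iteration\<close>


definition picard_step :: "(real \<Rightarrow> real^3) \<Rightarrow> (real \<Rightarrow> real \<Rightarrow> real^3) \<Rightarrow> real \<Rightarrow> real \<Rightarrow> real^3" where
  "picard_step X Y t \<xi> = X \<xi> + integral {0..t} (\<lambda>s. self_velocity (Y s) \<xi>)"

text \<open>
  Integrating \<open>L * c * exp (2 * L * s)\<close> up to time \<open>t\<close> gives at most \<open>c / 2 * exp (2 * L * t)\<close>: the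
  weight turns the Lipschitz bound into a contraction by \<open>1 / 2\<close>, whatever the length of the time
  interval.
\<close>
lemma picard_step_contraction:
  assumes Y: "\<And>t. t \<in> {0..T} \<Longrightarrow> hoelder_ball \<gamma> R (Y t)" "\<And>t. t \<in> {0..T} \<Longrightarrow> Y t 1 = Y t 0"
    and Z: "\<And>t. t \<in> {0..T} \<Longrightarrow> hoelder_ball \<gamma> R (Z t)" "\<And>t. t \<in> {0..T} \<Longrightarrow> Z t 1 = Z t 0"
    and intY: "\<And>t \<xi>. t \<in> {0..T} \<Longrightarrow> \<xi> \<in> {0..1} \<Longrightarrow> (\<lambda>s. self_velocity (Y s) \<xi>) integrable_on {0..t}"
    and intZ: "\<And>t \<xi>. t \<in> {0..T} \<Longrightarrow> \<xi> \<in> {0..1} \<Longrightarrow> (\<lambda>s. self_velocity (Z s) \<xi>) integrable_on {0..t}"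
    and close: "\<And>t. t \<in> {0..T} \<Longrightarrow> hoelder_ball \<gamma> (c * exp (2 * lipschitz R * t)) (\<lambda>\<xi>. Y t \<xi> - Z t \<xi>)"
    and t: "t \<in> {0..T}"
  shows "hoelder_ball \<gamma> (c / 2 * exp (2 * lipschitz R * t)) (\<lambda>\<xi>. picard_step X Y t \<xi> - picard_step X Z t \<xi>)"
proof -
  let ?L = "lipschitz R"
  have c: "c \<ge> 0" using hoelder_ball_nonneg[OF close[OF t]] by (simp add: zero_le_mult_iff)
  have "((\<lambda>s. ?L * (c * exp (2 * ?L * s))) has_integral
      c / 2 * exp (2 * ?L * t) - c / 2 * exp (2 * ?L * 0)) {0..t}"
    using t by (intro fundamental_theorem_of_calculus)
      (auto intro!: derivative_eq_intros simp flip: has_real_derivative_iff_has_vector_derivative)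
  then have "hoelder_ball \<gamma> (c / 2 * exp (2 * ?L * t) - c / 2 * exp (2 * ?L * 0))
      (\<lambda>\<xi>. integral {0..t} (\<lambda>s. self_velocity (Y s) \<xi> - self_velocity (Z s) \<xi>))"
    by (intro hoelder_ball_integral integrable_diff intY intZ t)
      (use t in \<open>auto intro!: self_velocity_lipschitz Y Z close\<close>)
  then have "hoelder_ball \<gamma> (c / 2 * exp (2 * ?L * t))
      (\<lambda>\<xi>. integral {0..t} (\<lambda>s. self_velocity (Y s) \<xi> - self_velocity (Z s) \<xi>))"
    by (rule hoelder_ball_mono) (use c in simp)
  then show ?thesis
    by (rule hoelder_ball_cong[THEN iffD1, rotated])
      (simp add: picard_step_def integral_diff[OF intY[OF t] intZ[OF t]])
qed

text \<open>
  Both paths lie in a common ball, which may be larger than the one used for existence. The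
  contraction on that ball bounds their weighted distance by half of itself, hence by zero.
\<close>
lemma picard_unique:
  assumes "Y \<in> continuous_hoelder_paths T \<gamma>" "Z \<in> continuous_hoelder_paths T \<gamma>" "T \<ge> 0"
    and intY: "\<And>t \<xi>. t \<in> {0..T} \<Longrightarrow> \<xi> \<in> {0..1} \<Longrightarrow> (\<lambda>s. self_velocity (Y s) \<xi>) integrable_on {0..t}"
    and intZ: "\<And>t \<xi>. t \<in> {0..T} \<Longrightarrow> \<xi> \<in> {0..1} \<Longrightarrow> (\<lambda>s. self_velocity (Z s) \<xi>) integrable_on {0..t}"
    and fixY: "\<And>t \<xi>. t \<in> {0..T} \<Longrightarrow> \<xi> \<in> {0..1} \<Longrightarrow> Y t \<xi> = picard_step X Y t \<xi>"
    and fixZ: "\<And>t \<xi>. t \<in> {0..T} \<Longrightarrow> \<xi> \<in> {0..1} \<Longrightarrow> Z t \<xi> = picard_step X Z t \<xi>"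
    and t: "t \<in> {0..T}" and \<xi>: "\<xi> \<in> {0..1}"
  shows "Y t \<xi> = Z t \<xi>"
proof -
  obtain R1 R2 where R12: "\<And>t. t \<in> {0..T} \<Longrightarrow> hoelder_ball \<gamma> R1 (Y t)" "\<And>t. t \<in> {0..T} \<Longrightarrow> hoelder_ball \<gamma> R2 (Z t)"
    using continuous_hoelder_paths_bounded assms(1,2,3) by metis
  define R where "R = max R1 R2"
  have Y: "hoelder_ball \<gamma> R (Y t)" "Y t 1 = Y t 0" and Z: "hoelder_ball \<gamma> R (Z t)" "Z t 1 = Z t 0"
    if "t \<in> {0..T}" for t
    using R12[OF that, THEN hoelder_ball_mono, of R] assms(1,2) that
    by (auto simp: R_def continuous_hoelder_paths_def intro: hoelder_curve_closed)
  have R: "R \<ge> 0" using Y(1)[OF t] by (rule hoelder_ball_nonneg)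
  have ball: "hoelder_ball \<gamma> (2 * R * (1 / 2) ^ n * exp (2 * lipschitz R * t)) (\<lambda>\<xi>. Y t \<xi> - Z t \<xi>)"
    if "t \<in> {0..T}" for n t
    using that
  proof (induction n arbitrary: t)
    case 0
    have "R + R \<le> 2 * R * (1 / 2) ^ 0 * exp (2 * lipschitz R * t)"
      using R lipschitz_pos[OF R] 0 mult_left_mono[of 1 "exp (2 * lipschitz R * t)" "2 * R"] by simp
    then show ?case using hoelder_ball_diff[OF Y(1) Z(1)] hoelder_ball_mono 0 by blast
  next
    case (Suc n)
    from picard_step_contraction[where X = X, OF Y Z intY intZ Suc.IH Suc.prems]
    have "hoelder_ball \<gamma> (2 * R * (1 / 2) ^ n / 2 * exp (2 * lipschitz R * t)) (\<lambda>\<xi>. Y t \<xi> - Z t \<xi>)"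
    proof (rule hoelder_ball_cong[THEN iffD1, rotated])
      fix \<xi> :: real assume \<xi>: "\<xi> \<in> {0..1}"
      show "picard_step X Y t \<xi> - picard_step X Z t \<xi> = Y t \<xi> - Z t \<xi>"
        by (simp only: fixY[OF Suc.prems \<xi>, symmetric] fixZ[OF Suc.prems \<xi>, symmetric])
    qed
    then show ?case by (simp add: mult_ac)
  qed
  have "(\<lambda>n. 2 * R * (1 / 2) ^ n * exp (2 * lipschitz R * t)) \<longlonglongrightarrow> 2 * R * 0 * exp (2 * lipschitz R * t)"
    by (intro tendsto_intros LIMSEQ_power_zero) simp
  moreover have "norm (Y t \<xi> - Z t \<xi>) \<le> 2 * R * (1 / 2) ^ n * exp (2 * lipschitz R * t)" for n
    using hoelder_ballD(1)[OF ball[OF t] \<xi>] .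
  ultimately have "norm (Y t \<xi> - Z t \<xi>) \<le> 0"
    using LIMSEQ_le_const by fastforce
  then show ?thesis by simp
qed

text \<open>
  The invariant of the Picard iteration. Lipschitz continuity in time is included for the sake of
  the integrals: it makes \<open>s \<mapsto> U(Y s) \<xi>\<close> continuous.
\<close>
definition admissible :: "real \<Rightarrow> real \<Rightarrow> real \<Rightarrow> (real \<Rightarrow> real \<Rightarrow> real^3) \<Rightarrow> bool" where
  "admissible T R M Y \<longleftrightarrow> (\<forall>t\<in>{0..T}. hoelder_ball \<gamma> R (Y t) \<and> Y t 1 = Y t 0) \<and>
     (\<forall>s\<in>{0..T}. \<forall>t\<in>{0..T}. hoelder_ball \<gamma> (M * \<bar>t - s\<bar>) (\<lambda>\<xi>. Y t \<xi> - Y s \<xi>))"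

lemma admissibleD:
  assumes "admissible T R M Y" "t \<in> {0..T}"
  shows "hoelder_ball \<gamma> R (Y t)" "Y t 1 = Y t 0"
    and "s \<in> {0..T} \<Longrightarrow> hoelder_ball \<gamma> (M * \<bar>t - s\<bar>) (\<lambda>\<xi>. Y t \<xi> - Y s \<xi>)"
  using assms by (auto simp: admissible_def)

lemma admissible_integrable:
  assumes Y: "admissible T R M Y" and "\<xi> \<in> {0..1}" and "{s..t} \<subseteq> {0..T}"
  shows "(\<lambda>r. self_velocity (Y r) \<xi>) integrable_on {s..t}"
proof -
  have "continuous_on {0..T} (\<lambda>r. self_velocity (Y r) \<xi>)"
    unfolding continuous_on_def
  proof
    fix x assume x: "x \<in> {0..T}"
    have "norm (self_velocity (Y r) \<xi> - self_velocity (Y x) \<xi>) \<le> lipschitz R * (M * \<bar>r - x\<bar>)" if "r \<in> {0..T}" for r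
      by (rule hoelder_ballD(1)[OF self_velocity_lipschitz \<open>\<xi> \<in> {0..1}\<close>])
        (use admissibleD[OF Y] x that in auto)
    then have "eventually (\<lambda>r. norm (self_velocity (Y r) \<xi> - self_velocity (Y x) \<xi>)
        \<le> lipschitz R * (M * \<bar>r - x\<bar>)) (at x within {0..T})"
      by (auto simp: eventually_at_filter)
    moreover have "((\<lambda>r. lipschitz R * (M * \<bar>r - x\<bar>)) \<longlongrightarrow> lipschitz R * (M * \<bar>x - x\<bar>)) (at x within {0..T})"
      by (intro tendsto_intros)
    then have "((\<lambda>r. lipschitz R * (M * \<bar>r - x\<bar>)) \<longlongrightarrow> 0) (at x within {0..T})" by simp
    ultimately have "((\<lambda>r. self_velocity (Y r) \<xi> - self_velocity (Y x) \<xi>) \<longlongrightarrow> 0) (at x within {0..T})"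
      by (rule Lim_null_comparison)
    then show "((\<lambda>r. self_velocity (Y r) \<xi>) \<longlongrightarrow> self_velocity (Y x) \<xi>) (at x within {0..T})"
      by (rule LIM_zero_cancel)
  qed
  then show ?thesis
    using assms(3) continuous_on_subset integrable_continuous_real by blast
qed

text \<open>
  By \<open>T * speed (\<rho> + 1) \<le> 1\<close>, a path that starts at \<open>X\<close> and moves with velocity at most
  \<open>speed (\<rho> + 1)\<close> stays within distance \<open>1\<close> of \<open>X\<close>.
\<close>
lemma admissible_picard_step:
  assumes X: "hoelder_ball \<gamma> \<rho> X" "X 1 = X 0" and T: "T * speed (\<rho> + 1) \<le> 1"
    and Y: "admissible T (\<rho> + 1) (speed (\<rho> + 1)) Y"
  shows "admissible T (\<rho> + 1) (speed (\<rho> + 1)) (picard_step X Y)"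
proof -
  let ?M = "speed (\<rho> + 1)"
  have M: "?M \<ge> 0" using hoelder_ball_nonneg[OF X(1)] by (intro speed_nonneg) simp
  have int: "hoelder_ball \<gamma> (?M * (t - s)) (\<lambda>\<xi>. integral {s..t} (\<lambda>r. self_velocity (Y r) \<xi>))"
    if "0 \<le> s" "s \<le> t" "t \<le> T" for s t
  proof (rule hoelder_ball_integral)
    show "hoelder_ball \<gamma> ?M (self_velocity (Y r))" if "r \<in> {s..t}" for r
      using admissibleD[OF Y, of r] that \<open>0 \<le> s\<close> \<open>t \<le> T\<close> by (intro self_velocity_bounded) auto
    show "((\<lambda>r. ?M) has_integral ?M * (t - s)) {s..t}"
      using has_integral_const_real[of ?M s t] \<open>s \<le> t\<close> by (simp add: mult.commute)
  qed (rule admissible_integrable[OF Y], use that in auto)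
  have increment: "hoelder_ball \<gamma> (?M * (t - s)) (\<lambda>\<xi>. picard_step X Y t \<xi> - picard_step X Y s \<xi>)"
    if "0 \<le> s" "s \<le> t" "t \<le> T" for s t
  proof (rule hoelder_ball_cong[THEN iffD1, OF _ int[OF that]])
    fix \<xi> :: real assume "\<xi> \<in> {0..1}"
    then have "(\<lambda>r. self_velocity (Y r) \<xi>) integrable_on {0..t}"
      using that by (intro admissible_integrable[OF Y]) auto
    from Henstock_Kurzweil_Integration.integral_combine[OF that(1,2) this]
    show "integral {s..t} (\<lambda>r. self_velocity (Y r) \<xi>) = picard_step X Y t \<xi> - picard_step X Y s \<xi>"
      by (simp add: picard_step_def algebra_simps)
  qed
  show ?thesis
    unfolding admissible_def
  proof (intro conjI ballI)
    fix t assume t: "t \<in> {0..T}"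
    have "?M * t \<le> ?M * T" using M t by (intro mult_left_mono) auto
    then have "?M * (t - 0) \<le> 1" using T by (simp add: mult.commute)
    then show "hoelder_ball \<gamma> (\<rho> + 1) (picard_step X Y t)"
      using hoelder_ball_add[OF X(1) hoelder_ball_mono[OF int[of 0 t]]] t by (simp add: picard_step_def[abs_def])
    have "integral {0..t} (\<lambda>s. self_velocity (Y s) 1) = integral {0..t} (\<lambda>s. self_velocity (Y s) 0)"
      by (rule integral_cong) (use admissibleD(2)[OF Y] t in \<open>auto simp: self_velocity_def\<close>)
    then show "picard_step X Y t 1 = picard_step X Y t 0" by (simp add: picard_step_def X(2))
    fix s assume s: "s \<in> {0..T}"
    show "hoelder_ball \<gamma> (?M * \<bar>t - s\<bar>) (\<lambda>\<xi>. picard_step X Y t \<xi> - picard_step X Y s \<xi>)"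
    proof (cases "s \<le> t")
      case True then show ?thesis using increment[of s t] s t by simp
    next
      case False then show ?thesis using hoelder_ball_minus[OF increment[of t s]] s t by simp
    qed
  qed
qed

primrec picard :: "(real \<Rightarrow> real^3) \<Rightarrow> nat \<Rightarrow> real \<Rightarrow> real \<Rightarrow> real^3" where
  "picard X 0 = (\<lambda>t. X)"
| "picard X (Suc n) = picard_step X (picard X n)"

text \<open>
  Successive iterates differ by at most \<open>2 * R * (1 / 2) ^ n\<close> in the weighted norm. Since the conditions in
  \<open>admissible\<close> are closed under pointwise limits, the limit is admissible, and then the contraction
  passes the iteration to the limit.
\<close>
lemma picard_converges:
  assumes X: "hoelder_ball \<gamma> \<rho> X" "X 1 = X 0" and T: "T * speed (\<rho> + 1) \<le> 1"
  obtains Y where "admissible T (\<rho> + 1) (speed (\<rho> + 1)) Y"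
    "\<And>t \<xi>. t \<in> {0..T} \<Longrightarrow> \<xi> \<in> {0..1} \<Longrightarrow> Y t \<xi> = picard_step X Y t \<xi>"
proof -
  define R M where RM: "R = \<rho> + 1" "M = speed (\<rho> + 1)"
  have R: "R \<ge> 0" using hoelder_ball_nonneg[OF X(1)] by (simp add: RM)
  have M: "M \<ge> 0" using speed_nonneg[OF R] by (simp add: RM)
  define w where "w t = exp (2 * lipschitz R * t)" for t
  have w: "w t \<ge> 1" if "t \<in> {0..T}" for t
    using that lipschitz_pos[OF R] by (simp add: w_def)
  have P: "admissible T R M (picard X n)" for n
  proof (induction n)
    case 0
    have "hoelder_ball \<gamma> (M * \<bar>t - s\<bar>) (\<lambda>\<xi>. X \<xi> - X \<xi>)" for s t
      using M by (intro hoelder_ballI) auto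
    then show ?case
      using X hoelder_ball_mono[OF X(1), of R] by (simp add: admissible_def RM)
  next
    case (Suc n)
    then show ?case using admissible_picard_step[OF X T] by (simp add: RM)
  qed
  have step: "hoelder_ball \<gamma> (c / 2 * w t) (\<lambda>\<xi>. picard_step X Y t \<xi> - picard_step X Z t \<xi>)"
    if "admissible T R M Y" "admissible T R M Z" "t \<in> {0..T}"
      and "\<And>t. t \<in> {0..T} \<Longrightarrow> hoelder_ball \<gamma> (c * w t) (\<lambda>\<xi>. Y t \<xi> - Z t \<xi>)" for Y Z c t
    unfolding w_def
    by (rule picard_step_contraction[OF admissibleD(1,2)[OF that(1)] admissibleD(1,2)[OF that(2)]
        admissible_integrable[OF that(1)] admissible_integrable[OF that(2)] that(4)[unfolded w_def] that(3)])
      auto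
  have incr: "hoelder_ball \<gamma> (2 * R * (1 / 2) ^ n * w t) (\<lambda>\<xi>. picard X (Suc n) t \<xi> - picard X n t \<xi>)"
    if "t \<in> {0..T}" for n t
    using that
  proof (induction n arbitrary: t)
    case 0
    have "R + R \<le> 2 * R * (1 / 2) ^ 0 * w t"
      using R mult_left_mono[OF w[OF 0], of "2 * R"] by simp
    then show ?case
      using hoelder_ball_diff[OF admissibleD(1)[OF P 0] admissibleD(1)[OF P 0]] hoelder_ball_mono by blast
  next
    case (Suc n)
    have "hoelder_ball \<gamma> (2 * R * (1 / 2) ^ n / 2 * w t)
        (\<lambda>\<xi>. picard_step X (picard X (Suc n)) t \<xi> - picard_step X (picard X n) t \<xi>)"
      by (rule step[OF P P Suc.prems Suc.IH])
    then show ?case by (simp add: mult_ac)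
  qed
  \<comment> \<open>The factor \<open>1 - (1 / 2) ^ k\<close> is the partial geometric sum.\<close>
  have tail: "hoelder_ball \<gamma> (4 * R * (1 / 2) ^ n * (1 - (1 / 2) ^ k) * w t)
      (\<lambda>\<xi>. picard X (n + k) t \<xi> - picard X n t \<xi>)" if t: "t \<in> {0..T}" for n k t
  proof (induction k)
    case 0
    show ?case by (simp add: hoelder_ball_def hoelder_bound_def)
  next
    case (Suc k)
    have "2 * R * (1 / 2) ^ (n + k) * w t + 4 * R * (1 / 2) ^ n * (1 - (1 / 2) ^ k) * w t
        = 4 * R * (1 / 2) ^ n * (1 - (1 / 2) ^ Suc k) * w t"
      by (simp add: power_add algebra_simps)
    then show ?case using hoelder_ball_add[OF incr[OF t, of "n + k"] Suc] by simp
  qed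
  have "convergent (\<lambda>n. picard X n t \<xi>)" if "t \<in> {0..T}" "\<xi> \<in> {0..1}" for t \<xi>
    by (rule convergent_geometric_steps[of _ "2 * R * w t" "1 / 2"])
      (use hoelder_ballD(1)[OF incr[OF that(1)] that(2)] in \<open>simp_all add: mult_ac\<close>)
  then obtain Y where lim: "\<And>t \<xi>. t \<in> {0..T} \<Longrightarrow> \<xi> \<in> {0..1} \<Longrightarrow> (\<lambda>n. picard X n t \<xi>) \<longlonglongrightarrow> Y t \<xi>"
    unfolding convergent_def by metis
  have Y: "admissible T R M Y"
    unfolding admissible_def
  proof (intro conjI ballI)
    fix t assume t: "t \<in> {0..T}"
    show "hoelder_ball \<gamma> R (Y t)"
      by (rule hoelder_ball_limit[OF admissibleD(1)[OF P t] tendsto_const lim[OF t]])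
    have "(\<lambda>n. picard X n t 1) \<longlonglongrightarrow> Y t 0"
      using lim[OF t, of 0] admissibleD(2)[OF P t] by simp
    then show "Y t 1 = Y t 0"
      using LIMSEQ_unique lim[OF t, of 1] by auto
    fix s assume s: "s \<in> {0..T}"
    show "hoelder_ball \<gamma> (M * \<bar>t - s\<bar>) (\<lambda>\<xi>. Y t \<xi> - Y s \<xi>)"
      by (rule hoelder_ball_limit[OF admissibleD(3)[OF P t s] tendsto_const tendsto_diff[OF lim[OF t] lim[OF s]]])
  qed
  have close: "hoelder_ball \<gamma> (4 * R * (1 / 2) ^ n * w t) (\<lambda>\<xi>. Y t \<xi> - picard X n t \<xi>)"
    if t: "t \<in> {0..T}" for n t
  proof (rule hoelder_ball_limit[OF _ tendsto_const])
    have "4 * R * (1 / 2) ^ n * (1 - (1 / 2) ^ k) * w t \<le> 4 * R * (1 / 2) ^ n * w t" for k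
      using R w[OF t] by (intro mult_right_mono mult_left_le) auto
    then show "hoelder_ball \<gamma> (4 * R * (1 / 2) ^ n * w t) (\<lambda>\<xi>. picard X (n + k) t \<xi> - picard X n t \<xi>)" for k
      using hoelder_ball_mono[OF tail[OF t]] by blast
    show "(\<lambda>k. picard X (n + k) t \<xi> - picard X n t \<xi>) \<longlonglongrightarrow> Y t \<xi> - picard X n t \<xi>" if "\<xi> \<in> {0..1}" for \<xi>
      using LIMSEQ_ignore_initial_segment[OF lim[OF t that], of n]
      by (intro tendsto_diff tendsto_const) (simp add: add.commute)
  qed
  have "Y t \<xi> = picard_step X Y t \<xi>" if t: "t \<in> {0..T}" and \<xi>: "\<xi> \<in> {0..1}" for t \<xi>
  proof (rule LIMSEQ_unique)
    show "(\<lambda>n. picard X (Suc n) t \<xi>) \<longlonglongrightarrow> Y t \<xi>"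
      by (rule LIMSEQ_Suc[OF lim[OF t \<xi>]])
    have "(\<lambda>n. 4 * R * (1 / 2) ^ n / 2 * w t) \<longlonglongrightarrow> 4 * R * 0 / 2 * w t"
      by (intro tendsto_intros LIMSEQ_power_zero) simp_all
    then have "(\<lambda>n. 4 * R * (1 / 2) ^ n / 2 * w t) \<longlonglongrightarrow> 0" by simp
    moreover have "eventually (\<lambda>n. norm (picard X (Suc n) t \<xi> - picard_step X Y t \<xi>)
        \<le> 4 * R * (1 / 2) ^ n / 2 * w t) sequentially"
      using hoelder_ballD(1)[OF step[OF Y P t close] \<xi>] by (simp add: norm_minus_commute)
    ultimately have "(\<lambda>n. picard X (Suc n) t \<xi> - picard_step X Y t \<xi>) \<longlonglongrightarrow> 0"
      by (rule Lim_null_comparison[rotated])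
    then show "(\<lambda>n. picard X (Suc n) t \<xi>) \<longlonglongrightarrow> picard_step X Y t \<xi>"
      by (rule LIM_zero_cancel)
  qed
  with Y show thesis using that by (simp add: RM)
qed

lemma is_solution_iff:
  "is_solution \<gamma> A X T Y \<longleftrightarrow> Y \<in> continuous_hoelder_paths T \<gamma> \<and>
     (\<forall>t\<in>{0..T}. \<forall>\<xi>\<in>{0..1}. (\<lambda>s. self_velocity (Y s) \<xi>) integrable_on {0..t} \<and> Y t \<xi> = picard_step X Y t \<xi>)"
  by (simp add: is_solution_def picard_step_def self_velocity_def)

lemma admissible_continuous_hoelder_path:
  assumes Y: "admissible T R M Y"
  shows "Y \<in> continuous_hoelder_paths T \<gamma>"
  unfolding continuous_hoelder_paths_def
proof (intro CollectI conjI ballI)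
  fix t assume t: "t \<in> {0..T}"
  show "Y t \<in> hoelder_curves \<gamma>"
    using \<gamma> admissibleD(1,2)[OF Y t] by (intro hoelder_ball_in_hoelder_curves) auto
  have "((\<lambda>s. ennreal (2 * (M * \<bar>s - t\<bar>))) \<longlongrightarrow> ennreal (2 * (M * \<bar>t - t\<bar>))) (at t within {0..T})"
    by (intro tendsto_intros)
  then have lim: "((\<lambda>s. ennreal (2 * (M * \<bar>s - t\<bar>))) \<longlongrightarrow> 0) (at t within {0..T})" by simp
  have bound: "eventually (\<lambda>s. hoelder_norm \<gamma> (\<lambda>\<xi>. Y s \<xi> - Y t \<xi>) \<le> ennreal (2 * (M * \<bar>s - t\<bar>))) (at t within {0..T})"
    using hoelder_norm_le[OF admissibleD(3)[OF Y _ t]] by (auto simp: eventually_at_filter)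
  show "((\<lambda>s. hoelder_norm \<gamma> (\<lambda>\<xi>. Y s \<xi> - Y t \<xi>)) \<longlongrightarrow> 0) (at t within {0..T})"
    by (rule tendsto_sandwich[OF _ bound tendsto_const lim]) simp
qed

lemma local_well_posedness:
  assumes X: "hoelder_ball \<gamma> \<rho> X" "X 1 = X 0" and T: "T \<ge> 0" "T * speed (\<rho> + 1) \<le> 1"
  shows "\<exists>Y. is_solution \<gamma> A X T Y \<and>
    (\<forall>Y'. is_solution \<gamma> A X T Y' \<longrightarrow> (\<forall>t\<in>{0..T}. \<forall>\<xi>\<in>{0..1}. Y' t \<xi> = Y t \<xi>))"
proof -
  obtain Y where Y: "admissible T (\<rho> + 1) (speed (\<rho> + 1)) Y"
    and fixpoint: "\<And>t \<xi>. t \<in> {0..T} \<Longrightarrow> \<xi> \<in> {0..1} \<Longrightarrow> Y t \<xi> = picard_step X Y t \<xi>"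
    using picard_converges[OF X T(2)] by blast
  have sol: "is_solution \<gamma> A X T Y"
    unfolding is_solution_iff
    using admissible_continuous_hoelder_path[OF Y] fixpoint
    by (auto intro!: admissible_integrable[OF Y])
  moreover have "Y' t \<xi> = Y t \<xi>" if "is_solution \<gamma> A X T Y'" "t \<in> {0..T}" "\<xi> \<in> {0..1}" for Y' t \<xi>
    by (rule picard_unique[of Y' T Y]) (use that sol T(1) in \<open>auto simp: is_solution_iff\<close>)
  ultimately show ?thesis by blast
qed

end

section \<open>Existence and uniqueness for short time\<close>

theorem theorem1:
  "\<exists>T0 :: ennreal \<Rightarrow> ennreal \<Rightarrow> real \<Rightarrow> real.
     \<forall>(\<gamma>::real) (A :: real^3 \<Rightarrow> real^3^3) (X :: real \<Rightarrow> real^3).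
       \<gamma> > 1/2 \<longrightarrow>
       field_differentiable_upto 3 2 (matrix_field A) \<longrightarrow>
       field_norm 2 3 (grad (matrix_field A)) < \<infinity> \<longrightarrow>
       X \<in> hoelder_curves \<gamma> \<longrightarrow>
       (let T = T0 (field_norm 1 3 (grad (matrix_field A))) (hoelder_norm \<gamma> X) \<gamma>
        in T > 0 \<and>
           (\<exists>Y. is_solution \<gamma> A X T Y \<and>
                (\<forall>Y'. is_solution \<gamma> A X T Y' \<longrightarrow>
                      (\<forall>t\<in>{0..T}. \<forall>\<xi>\<in>{0..1}. Y' t \<xi> = Y t \<xi>))))"
  \<comment> \<open>Increments of order one and two cost \<open>9 * 3\<close> and \<open>9 * 9\<close>, whence \<open>81\<close>.
    The \<open>1\<close> in the denominator covers vanishing speed.\<close>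
proof (rule exI[of _ "\<lambda>N h \<gamma>. 1 / (hoelder_flow.speed \<gamma> (81 * enn2real N) (enn2real h + 1) + 1)"],
    intro allI impI)
  fix \<gamma> :: real and A :: "real^3 \<Rightarrow> real^3^3" and X :: "real \<Rightarrow> real^3"
  assume \<gamma>: "\<gamma> > 1/2" and diff: "field_differentiable_upto 3 2 (matrix_field A)"
    and fin2: "field_norm 2 3 (grad (matrix_field A)) < \<infinity>" and X: "X \<in> hoelder_curves \<gamma>"
  have fin1: "field_norm 1 3 (grad (matrix_field A)) < \<infinity>"
    using field_norm_mono[of 1 2] fin2 by (meson le_less_trans one_le_numeral)
  define N1 N2 \<rho> where defs: "N1 = enn2real (field_norm 1 3 (grad (matrix_field A)))"
    "N2 = enn2real (field_norm 2 3 (grad (matrix_field A)))" "\<rho> = enn2real (hoelder_norm \<gamma> X)"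
  have N: "N1 \<ge> 0" "N2 \<ge> 0" "\<rho> \<ge> 0" by (simp_all add: defs)
  interpret hoelder_flow \<gamma> A "81 * N1" "243 * N2"
  proof
    fix h k l p :: "real^3"
    have "norm (increment [h] A p) \<le> 27 * N1 * norm h"
      using increment_matrix_field_le[OF diff _ fin1, of "[h]" p] by (simp add: defs)
    also have "\<dots> \<le> 81 * N1 * norm h" using N by (intro mult_right_mono) auto
    finally show "norm (increment [h] A p) \<le> 81 * N1 * norm h" .
    show "norm (increment [h, k] A p) \<le> 81 * N1 * (norm h * norm k)"
      using increment_matrix_field_le[OF diff _ fin1, of "[h, k]" p] by (simp add: defs)
    show "norm (increment [h, k, l] A p) \<le> 243 * N2 * (norm h * norm k * norm l)"
      using increment_matrix_field_le[OF diff _ fin2, of "[h, k, l]" p] by (simp add: defs mult_ac)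
  qed (use \<gamma> N in auto)
  define T where "T = 1 / (speed (\<rho> + 1) + 1)"
  have s: "speed (\<rho> + 1) \<ge> 0" using N by (intro speed_nonneg) simp
  then have T: "T > 0" "T * speed (\<rho> + 1) \<le> 1" by (auto simp: T_def divide_simps)
  have "\<exists>Y. is_solution \<gamma> A X T Y \<and>
      (\<forall>Y'. is_solution \<gamma> A X T Y' \<longrightarrow> (\<forall>t\<in>{0..T}. \<forall>\<xi>\<in>{0..1}. Y' t \<xi> = Y t \<xi>))"
    using T hoelder_ball_hoelder_curve[OF X] hoelder_curve_closed[OF X]
    by (intro local_well_posedness[of \<rho>]) (auto simp: defs)
  with T(1) show "let T = 1 / (hoelder_flow.speed \<gamma> (81 * enn2real (field_norm 1 3 (grad (matrix_field A))))
        (enn2real (hoelder_norm \<gamma> X) + 1) + 1)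
     in T > 0 \<and> (\<exists>Y. is_solution \<gamma> A X T Y \<and>
        (\<forall>Y'. is_solution \<gamma> A X T Y' \<longrightarrow> (\<forall>t\<in>{0..T}. \<forall>\<xi>\<in>{0..1}. Y' t \<xi> = Y t \<xi>)))"
    by (simp add: Let_def T_def defs)
qed

end
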